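(* Let $t\in\{1,2\}$ and let $n$ be a positive integer with $n\equiv 3-t\pmod 3$. Then, modulo $(1-aq^{tn})(a-q^{tn})(b-q^{tn})$, \begin{align*} &\sum_{k=0}^{(tn+1)/3}\frac{(aq^{-1},q^{-1}/a,q^{-1}/b;q^3)_k}{(q^3;q^3)_k^2(q^3/b;q^3)_k}q^{9k}\\ &\quad\equiv\,\frac{(b-q^{tn})(ab-1-a^2+aq^{tn})}{(a-b)(1-ab)}\frac{(bq,q;q^3)_{(tn+1)/3}}{(bq)^{(tn+1)/3}(1/b,q^3;q^3)_{(tn+1)/3}}A_n(q;b,t)\\ &\qquad+\: \frac{(1-aq^{tn})(a-q^{tn})}{(a-b)(1-ab)}\frac{(aq,q/a;q^3)_{(tn+1)/3}}{b^{(tn+1)/3}(1/b,1/bq;q^3)_{(tn+1)/3}}B(q;a,b), \end{align*} where \begin{align*} A_n(q;b,t)&=\frac{b(1-q^{tn+1})\{q^{tn+2}/b-q+q^{tn-1}(1+q^3-q^{tn+2}-q^2/b)\}}{(1-q)(1-bq^{tn-1})(1-q^{tn+1}/b)}\\ &\quad-\frac{1-q^{tn-2}/b-q^{tn+1}(2-q^{tn-1}-q^{-1}/b)}{(1-q^{tn-1})(1-q^{-1}/b)},\\ B(q;a,b)&=\frac{(1-bq)\{1-q-b(q^{-2}+q-a-1/a)\}}{q(1-q)(1-ab/q)(1-b/aq)} -\frac{1-q^{-2}-b(2q-a-1/a)}{bq(1-aq^{-1})(1-q^{-1}/a)}. \end{align*}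
   Context: Here $q,a,b$ are indeterminates. The $q$-shifted factorial is $(x;q)_0=1$, $(x;q)_k=(1-x)(1-xq)\cdots(1-xq^{k-1})$ for positive integers $k$, and $(x_1,\dots,x_r;q)_k=(x_1;q)_k\cdots(x_r;q)_k$; similarly with base $q^3$. The congruence is between rational functions in $q,a,b$ whose denominators are coprime to the modulus $(1-aq^{tn})(a-q^{tn})(b-q^{tn})$: it means the numerator of the difference of the two sides is divisible by this polynomial. *)

theory Defs
  imports "HOL-Computational_Algebra.Computational_Algebra"
    "HOL-Computational_Algebra.Field_as_Ring" "HOL-Number_Theory.Cong"
begin

text \<open>
  Polynomials in \<open>q, a, b\<close> are represented as elements of \<open>\<rat>[q][a][b]\<close>, and rational functions
  as elements of its fraction field.
\<close>

type_synonym qab_poly = "rat poly poly poly"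
type_synonym qab_rat = "qab_poly fract"

definition q_poly :: qab_poly where "q_poly = [:[:[:0, 1:]:]:]"
definition a_poly :: qab_poly where "a_poly = [:[:0, 1:]:]"
definition b_poly :: qab_poly where "b_poly = [:0, 1:]"

definition q_var :: qab_rat where "q_var = to_fract q_poly"
definition a_var :: qab_rat where "a_var = to_fract a_poly"
definition b_var :: qab_rat where "b_var = to_fract b_poly"

text \<open>
  Congruence of rational functions modulo a polynomial: \<open>quot_of_fract\<close> yields numerator and
  denominator in lowest terms; both sides must have denominator coprime to the modulus.
\<close>

definition rat_cong :: "qab_poly \<Rightarrow> qab_rat \<Rightarrow> qab_rat \<Rightarrow> bool" where
  "rat_cong m x y \<longleftrightarrow>
     coprime (snd (quot_of_fract x)) m \<and>
     coprime (snd (quot_of_fract y)) m \<and>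
     m dvd fst (quot_of_fract (x - y))"

definition qpoch :: "'a::comm_ring_1 \<Rightarrow> 'a \<Rightarrow> nat \<Rightarrow> 'a" where
  "qpoch x q k = (\<Prod>j<k. 1 - x * q ^ j)"

text \<open>
  The natural-number exponents \<open>t * n - 1\<close> and \<open>t * n - 2\<close> below do not truncate when
  \<open>t * n \<equiv> 2 (mod 3)\<close>, since then \<open>t * n \<ge> 2\<close>.
\<close>

definition A_fun :: "nat \<Rightarrow> 'a::field \<Rightarrow> 'a \<Rightarrow> nat \<Rightarrow> 'a" where
  "A_fun n q b t =
     b * (1 - q ^ (t * n + 1)) *
       (q ^ (t * n + 2) / b - q + q ^ (t * n - 1) * (1 + q ^ 3 - q ^ (t * n + 2) - q ^ 2 / b))
       / ((1 - q) * (1 - b * q ^ (t * n - 1)) * (1 - q ^ (t * n + 1) / b))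
     - (1 - q ^ (t * n - 2) / b - q ^ (t * n + 1) * (2 - q ^ (t * n - 1) - inverse q / b))
       / ((1 - q ^ (t * n - 1)) * (1 - inverse q / b))"

definition B_fun :: "'a::field \<Rightarrow> 'a \<Rightarrow> 'a \<Rightarrow> 'a" where
  "B_fun q a b =
     (1 - b * q) * (1 - q - b * (inverse (q ^ 2) + q - a - 1 / a))
       / (q * (1 - q) * (1 - a * b / q) * (1 - b / (a * q)))
     - (1 - inverse (q ^ 2) - b * (2 * q - a - 1 / a))
       / (b * q * (1 - a * inverse q) * (1 - inverse q / a))"

definition lhs_sum :: "'a::field \<Rightarrow> 'a \<Rightarrow> 'a \<Rightarrow> nat \<Rightarrow> 'a" where
  "lhs_sum q a b N =
     (\<Sum>k=0..N.
        qpoch (a * inverse q) (q ^ 3) k * qpoch (inverse q / a) (q ^ 3) k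
          * qpoch (inverse q / b) (q ^ 3) k
        / ((qpoch (q ^ 3) (q ^ 3) k) ^ 2 * qpoch (q ^ 3 / b) (q ^ 3) k)
        * q ^ (9 * k))"

definition rhs_expr :: "'a::field \<Rightarrow> 'a \<Rightarrow> 'a \<Rightarrow> nat \<Rightarrow> nat \<Rightarrow> nat \<Rightarrow> 'a" where
  "rhs_expr q a b t n N =
     (b - q ^ (t * n)) * (a * b - 1 - a ^ 2 + a * q ^ (t * n)) / ((a - b) * (1 - a * b))
       * (qpoch (b * q) (q ^ 3) N * qpoch q (q ^ 3) N
          / ((b * q) ^ N * (qpoch (1 / b) (q ^ 3) N * qpoch (q ^ 3) (q ^ 3) N)))
       * A_fun n q b t
     + (1 - a * q ^ (t * n)) * (a - q ^ (t * n)) / ((a - b) * (1 - a * b))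
       * (qpoch (a * q) (q ^ 3) N * qpoch (q / a) (q ^ 3) N
          / (b ^ N * (qpoch (1 / b) (q ^ 3) N * qpoch (1 / (b * q)) (q ^ 3) N)))
       * B_fun q a b"

end

theory Submission
  imports Defs
begin

text \<open>
  The three factors of the modulus are pairwise coprime primes, so it suffices to compare both sides
  after substituting \<open>b = q\<^sup>m\<close>, \<open>a = q\<^sup>m\<close> and \<open>a = q\<^sup>-\<^sup>m\<close>, where \<open>m = t n = 3 N - 1\<close>. With \<open>Q = q\<^sup>3\<close>, the
  left-hand side becomes in each case a terminating sum
  \<open>\<Sum>k. (A, B, Q\<^sup>-\<^sup>N; Q)\<^sub>k / ((Q; Q)\<^sub>k\<^sup>2 (A B Q\<^sup>2\<^sup>-\<^sup>N; Q)\<^sub>k) Q\<^sup>3\<^sup>k\<close>. Writing \<open>x = Q\<^sup>k\<close> and expressing \<open>x\<^sup>2\<close> in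
  the basis \<open>(1 - A x) (1 - B x)\<close>, \<open>(1 - A x) (1 - A Q x)\<close>, \<open>(1 - B x) (1 - B Q x)\<close> of the
  quadratic polynomials turns this sum into a combination of three balanced sums, each of which is
  evaluated by the \<open>q\<close>-Pfaff-Saalschuetz formula.
\<close>

section \<open>The q-Saalschuetz summation\<close>

text \<open>The two prefactors on the right are Chinese remainder coefficients. The first is 0 at
  \<open>b = q^m\<close> and 1 at \<open>a = q^m\<close> and \<open>a = q^-m\<close>; the second is
  1 at \<open>b = q^m\<close> and 0 at the other two roots. So at each root a single closed form
  remains, and it has to be the value of the sum there.

  The choice of basis comes from the balance condition. With argument \<open>Q^k\<close> and lower
  parameters \<open>Q, Q, E\<close>, balance would force \<open>E = A B Q^-N\<close>, but the actual
  one is \<open>A B Q^(2-N)\<close>. Since \<open>(1 - c x) (c; Q)_k = (1 - c) (c Q; Q)_k\<close>,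
  each of the three basis products multiplies the product of the upper parameters by
  \<open>Q^2\<close>. This absorbs the surplus \<open>x^2\<close> of the argument and restores the
  balance, with the same lower parameters in all three sums.

  The obstacle is division: the coefficients in this basis have poles, and the two sides have
  denominators that must survive each substitution. Hence the conditions that \<open>a^2\<close>, or
  \<open>b\<close>, is not a quotient of powers of \<open>q\<close>, and the separate record of
  nonvanishing denominators.\<close>

lemma qpoch_0 [simp]: "qpoch x q 0 = 1"
  by (simp add: qpoch_def)

lemma qpoch_Suc: "qpoch x q (Suc k) = qpoch x q k * (1 - x * q ^ k)"
  by (simp add: qpoch_def)

lemma qpoch_Suc_shift: "qpoch x q (Suc k) = (1 - x) * qpoch (x * q) q k"
  by (simp add: qpoch_def prod.lessThan_Suc_shift mult.assoc del: prod.lessThan_Suc)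

lemma qpoch_shift: "(1 - x) * qpoch (x * q) q k = qpoch x q k * (1 - x * q ^ k)"
  by (metis qpoch_Suc qpoch_Suc_shift)

lemma qpoch_eq_shift:
  fixes x q :: "'a::field"
  shows "x * q ^ k \<noteq> 1 \<Longrightarrow> qpoch x q k = (1 - x) * qpoch (x * q) q k / (1 - x * q ^ k)"
  using qpoch_shift[of x q k] by simp

lemma qpoch_eq_0_iff:
  fixes x q :: "'a::field"
  shows "qpoch x q k = 0 \<longleftrightarrow> (\<exists>j<k. x * q ^ j = 1)"
  by (auto simp: qpoch_def)

definition saal_term :: "'a::field \<Rightarrow> 'a \<Rightarrow> 'a \<Rightarrow> 'a \<Rightarrow> 'a \<Rightarrow> 'a \<Rightarrow> nat \<Rightarrow> 'a" where
  "saal_term Q A B c D E k =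
     qpoch A Q k * qpoch B Q k * qpoch c Q k * Q ^ k / (qpoch Q Q k * qpoch D Q k * qpoch E Q k)"

text \<open>The balanced sums for \<open>N + 1\<close> and \<open>N\<close> differ by a multiple of a single balanced sum for \<open>N\<close>
  with shifted parameters, so the summation formula follows by induction.\<close>

lemma saal_term_diff:
  fixes Q A B c D E :: "'a::field"
  assumes "Q \<noteq> 0" "\<And>i. Q * Q ^ i \<noteq> 1" "\<And>i. D * Q ^ i \<noteq> 1" "E \<noteq> Q" "\<And>i. E * Q ^ i \<noteq> 1"
  shows "saal_term Q A B (c / Q) D (E / Q) (Suc j) - saal_term Q A B c D E (Suc j) =
    (1 - A) * (1 - B) * (E - c) * Q / ((1 - D) * (1 - E) * (Q - E)) *
      saal_term Q (A * Q) (B * Q) c (D * Q) (E * Q) j"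
proof -
  define x where "x = Q ^ j"
  define pE where "pE = qpoch (E * Q) Q j"
  define pD where "pD = qpoch (D * Q) Q j"
  define pQ where "pQ = qpoch Q Q j"
  have nz: "pE \<noteq> 0" "pD \<noteq> 0" "pQ \<noteq> 0" "1 - E \<noteq> 0" "1 - D \<noteq> 0" "1 - E * x \<noteq> 0" "1 - Q * x \<noteq> 0" "Q - E \<noteq> 0"
    using assms(2)[of "_"] assms(3)[of "Suc _"] assms(3)[of 0] assms(4) assms(5)[of "Suc _"]
      assms(5)[of 0] assms(5)[of j]
    by (auto simp: pE_def pD_def pQ_def x_def qpoch_eq_0_iff mult.assoc)
  have e1: "qpoch E Q (Suc j) = (1 - E) * pE" by (simp add: pE_def qpoch_Suc_shift)
  have e2: "qpoch (E / Q) Q (Suc j) = (1 - E / Q) * ((1 - E) * pE / (1 - E * x))"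
    using qpoch_eq_shift[OF assms(5)[of j]] assms(1)
    by (simp add: pE_def qpoch_Suc_shift x_def)
  have c1: "qpoch c Q (Suc j) = qpoch c Q j * (1 - c * x)" by (simp add: qpoch_Suc x_def)
  have c2: "qpoch (c / Q) Q (Suc j) = (1 - c / Q) * qpoch c Q j"
    using assms(1) by (simp add: qpoch_Suc_shift)
  have q1: "qpoch Q Q (Suc j) = pQ * (1 - Q * x)" by (simp add: qpoch_Suc x_def pQ_def)
  have d1: "qpoch D Q (Suc j) = (1 - D) * pD" by (simp add: qpoch_Suc_shift pD_def)
  define pA where "pA = qpoch (A * Q) Q j"
  define pB where "pB = qpoch (B * Q) Q j"
  define pc where "pc = qpoch c Q j"
  \<comment> \<open>\<open>M\<close> is what both terms share. They differ only in the factors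
    containing \<open>c\<close> and \<open>E\<close>, so the claim reduces to the rational identity
    \<open>K\<close>, whose factor \<open>1 - Q x\<close> cancels in \<open>M\<close>.\<close>
  define M where "M = (1 - A) * pA * ((1 - B) * pB) * pc * (Q * x) / (pQ * (1 - Q * x) * ((1 - D) * pD) * ((1 - E) * pE))"
  have L1: "saal_term Q A B (c / Q) D (E / Q) (Suc j) = M * ((1 - c / Q) * (1 - E * x) / (1 - E / Q))"
    unfolding saal_term_def e2 c2 q1 d1 qpoch_Suc_shift[of A] qpoch_Suc_shift[of B]
      pA_def[symmetric] pB_def[symmetric] pc_def[symmetric] M_def
    by (simp add: x_def[symmetric] mult_ac)
  have L2: "saal_term Q A B c D E (Suc j) = M * (1 - c * x)"
    unfolding saal_term_def e1 c1 q1 d1 qpoch_Suc_shift[of A] qpoch_Suc_shift[of B]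
      pA_def[symmetric] pB_def[symmetric] pc_def[symmetric] M_def
    by (simp add: x_def[symmetric] mult_ac)
  have K: "(1 - c / Q) * (1 - E * x) / (1 - E / Q) - (1 - c * x) = (E - c) * (1 - Q * x) / (Q - E)"
    using nz assms(1) by (simp add: divide_simps) (simp add: algebra_simps)
  show ?thesis unfolding L1 L2 right_diff_distrib[symmetric] K
    unfolding M_def saal_term_def pA_def[symmetric] pB_def[symmetric] pc_def[symmetric] pD_def[symmetric] pE_def[symmetric] pQ_def[symmetric] x_def[symmetric]
    using nz by (simp add: divide_simps)
qed

text \<open>The last two hypotheses say that \<open>A B / D\<close> is not an integer power of
  \<open>Q\<close>. This keeps every factor of the lower factorials in \<open>E\<close> nonzero, and
  it is stable under replacing \<open>A, B, D\<close> by \<open>A Q, B Q, D Q\<close>, the shift to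
  which the induction hypothesis is applied a second time.\<close>

theorem q_saalschuetz:
  fixes Q A B D :: "'a::field"
  assumes "Q \<noteq> 0" "\<And>i. Q * Q ^ i \<noteq> 1" "A \<noteq> 0" "B \<noteq> 0" "D \<noteq> 0" "\<And>i. D * Q ^ i \<noteq> 1"
    and "\<And>i. A * B * Q ^ i \<noteq> D" "\<And>i. A * B \<noteq> D * Q ^ i"
  shows "(\<Sum>k\<le>N. saal_term Q A B (1 / Q ^ N) D (A * B * Q / (D * Q ^ N)) k) =
    qpoch (D / A) Q N * qpoch (D / B) Q N / (qpoch D Q N * qpoch (D / (A * B)) Q N)"
  using assms
proof (induction N arbitrary: A B D)
  case 0
  then show ?case by (simp add: saal_term_def)
next
  case (Suc N)
  note h = Suc.prems
  define x where "x = Q ^ N"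
  define E where "E = A * B * Q / (D * x)"
  have x0: "x \<noteq> 0" using h(1) by (simp add: x_def)
  have E1: "E * Q ^ i \<noteq> 1" for i
  proof
    assume "E * Q ^ i = 1"
    then have *: "A * B * Q * Q ^ i = D * Q ^ N" using h x0 by (simp add: E_def x_def field_simps)
    show False
    proof (cases "Suc i \<le> N")
      case True
      then have "Q ^ N = Q ^ (N - Suc i) * (Q * Q ^ i)" by (metis le_add_diff_inverse2 power_Suc power_add)
      with * h(1) have "A * B = D * Q ^ (N - Suc i)" by simp
      then show False using h(8) by blast
    next
      case False
      then have "Q * Q ^ i = Q ^ (Suc i - N) * Q ^ N" by (metis nat_le_linear le_add_diff_inverse2 power_Suc power_add)
      with * h(1) have "A * B * Q ^ (Suc i - N) = D" by (simp add: mult.assoc)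
      then show False using h(7) by blast
    qed
  qed
  have EQ: "E \<noteq> Q"
  proof
    assume "E = Q"
    then have "A * B = D * Q ^ N" using h x0 by (simp add: E_def x_def field_simps)
    then show False using h(8) by blast
  qed
  define \<kappa> where "\<kappa> = (1 - A) * (1 - B) * (E - 1 / x) * Q / ((1 - D) * (1 - E) * (Q - E))"
  define r where "r = qpoch (D / A) Q N * qpoch (D / B) Q N / (qpoch D Q N * qpoch (D / (A * B)) Q N)"
  have IH1: "(\<Sum>k\<le>N. saal_term Q A B (1 / x) D E k) = r"
    unfolding x_def E_def r_def by (rule Suc.IH) (use h in auto)
  have IH2: "(\<Sum>k\<le>N. saal_term Q (A * Q) (B * Q) (1 / x) (D * Q) (E * Q) k) =
    qpoch (D / A) Q N * qpoch (D / B) Q N / (qpoch (D * Q) Q N * qpoch (D / (A * B * Q)) Q N)"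
  proof -
    have *: "E * Q = A * Q * (B * Q) * Q / (D * Q * Q ^ N)" using h x0 by (simp add: E_def x_def)
    have "A * B * Q * Q ^ i \<noteq> D" for i using h(7)[of "Suc i"] by (simp add: mult.assoc)
    moreover have "A * B * Q \<noteq> D * Q ^ i" for i
      using h(8)[of "i - 1"] h(7)[of 1] h(1) by (cases i) auto
    moreover have "D * Q * Q ^ i \<noteq> 1" for i using h(6)[of "Suc i"] by (simp add: mult.assoc)
    ultimately show ?thesis using Suc.IH[of "A * Q" "B * Q" "D * Q"] h
      unfolding * x_def by (simp add: mult_ac)
  qed
  \<comment> \<open>The factor \<open>1 - Q^-N Q^N\<close> vanishes, so the sum for \<open>N\<close>
    may be extended by one term and compared termwise with the sum for \<open>Suc N\<close>.\<close>
  have last0: "saal_term Q A B (1 / x) D E (Suc N) = 0"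
    using h(1) by (simp add: saal_term_def qpoch_Suc x_def)
  have "(\<Sum>k\<le>Suc N. saal_term Q A B (1 / x / Q) D (E / Q) k) - r =
     (\<Sum>k\<le>Suc N. saal_term Q A B (1 / x / Q) D (E / Q) k - saal_term Q A B (1 / x) D E k)"
    unfolding sum_subtractf IH1[symmetric] by (simp add: last0)
  \<comment> \<open>The terms at \<open>k = 0\<close> are both 1 and cancel; the remaining indices
    shift down by one.\<close>
  also have "\<dots> = (\<Sum>k\<le>N. \<kappa> * saal_term Q (A * Q) (B * Q) (1 / x) (D * Q) (E * Q) k)"
    using saal_term_diff[of Q D E A B "1 / x"] h E1 EQ
    by (simp add: sum.atMost_Suc_shift \<kappa>_def saal_term_def[of _ _ _ _ _ _ 0] del: sum.atMost_Suc)
  also have "\<dots> = \<kappa> * (qpoch (D / A) Q N * qpoch (D / B) Q N / (qpoch (D * Q) Q N * qpoch (D / (A * B * Q)) Q N))"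
    by (simp add: sum_distrib_left[symmetric] IH2)
  also have "qpoch (D * Q) Q N = qpoch D Q N * (1 - D * x) / (1 - D)"
    using qpoch_shift[of D Q N] h(6)[of 0] by (simp add: x_def field_simps)
  also have "qpoch (D / (A * B * Q)) Q N = qpoch (D / (A * B)) Q N * (1 - D / (A * B * Q)) / (1 - D * x / (A * B * Q))"
    using qpoch_eq_shift[of "D / (A * B * Q)" Q N] E1[of 0] h(1,3,4,5) x0
    by (simp add: x_def E_def divide_simps mult_ac)
  finally have *: "(\<Sum>k\<le>Suc N. saal_term Q A B (1 / x / Q) D (E / Q) k) - r =
     \<kappa> * (qpoch (D / A) Q N * qpoch (D / B) Q N / (qpoch D Q N * (1 - D * x) / (1 - D) *
       (qpoch (D / (A * B)) Q N * (1 - D / (A * B * Q)) / (1 - D * x / (A * B * Q)))))" .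
  have "(\<Sum>k\<le>Suc N. saal_term Q A B (1 / x / Q) D (E / Q) k) =
     r * (1 + \<kappa> * ((1 - D) * (1 - D * x / (A * B * Q)) / ((1 - D * x) * (1 - D / (A * B * Q)))))"
    using * by (simp add: r_def diff_eq_eq distrib_left mult_ac)
  \<comment> \<open>The right-hand side is the quotient of the new factors that the four factorials
    of the closed form gain when \<open>N\<close> becomes \<open>Suc N\<close>.\<close>
  also have "1 + \<kappa> * ((1 - D) * (1 - D * x / (A * B * Q)) / ((1 - D * x) * (1 - D / (A * B * Q)))) =
    (1 - D / A * x) * (1 - D / B * x) / ((1 - D * x) * (1 - D / (A * B) * x))"
  proof -
    have n: "1 - D * x \<noteq> 0" "1 - D \<noteq> 0" "A * B - D * x \<noteq> 0" "A * B * Q - D \<noteq> 0" "A * B * Q - D * x \<noteq> 0"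
      using h(6)[of N] h(6)[of 0] h(8)[of N] h(7)[of 1] E1[of 0] h(1-5) x0
      by (auto simp: x_def E_def field_simps)
    have k: "\<kappa> = (1 - A) * (1 - B) * (A * B * Q - D) * (D * x) / ((1 - D) * (D * x - A * B * Q) * (D * x - A * B))"
    proof -
      have 1: "E - 1 / x = (A * B * Q - D) / (D * x)" "1 - E = (D * x - A * B * Q) / (D * x)"
        "Q - E = Q * (D * x - A * B) / (D * x)"
        using h(5) x0 by (simp_all add: E_def field_simps)
      show ?thesis unfolding \<kappa>_def 1 using h(1,5) x0 by (simp add: mult.assoc)
    qed
    have 2: "1 - D * x / (A * B * Q) = (A * B * Q - D * x) / (A * B * Q)"
      "1 - D / (A * B * Q) = (A * B * Q - D) / (A * B * Q)"
      using h(1,3,4) by (simp_all add: field_simps)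
    have 4: "\<kappa> * ((1 - D) * (1 - D * x / (A * B * Q)) / ((1 - D * x) * (1 - D / (A * B * Q)))) =
       (1 - A) * (1 - B) * (D * x) / ((1 - D * x) * (A * B - D * x))"
    proof -
      define u where "u = A * B * Q - D * x"
      define v where "v = A * B - D * x"
      have 3: "D * x - A * B * Q = - u" "D * x - A * B = - v" by (simp_all add: u_def v_def)
      have "u \<noteq> 0" "v \<noteq> 0" using n by (auto simp: u_def v_def)
      then show ?thesis unfolding k 2 3 u_def[symmetric] v_def[symmetric]
        using n h(1,3,4) by (simp add: mult_ac)
    qed
    show ?thesis unfolding 4 using n h(3,4) by (simp add: divide_simps) (simp add: algebra_simps)
  qed
  finally show ?case unfolding r_def E_def x_def
    by (simp add: qpoch_Suc mult_ac)
qed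

section \<open>A contiguous sum\<close>

text \<open>The apparent poles at \<open>A = B\<close>, \<open>A = B Q\<close> and \<open>B = A Q\<close> of the combination of the three
  balanced sums cancel; this is what remains.\<close>

definition contig_factor :: "'a::field \<Rightarrow> 'a \<Rightarrow> 'a \<Rightarrow> 'a \<Rightarrow> 'a" where
  "contig_factor Q A B u =
     (Q * (1 - A * B) * (1 - A * B * Q) - (1 + Q) * (2 - A - B) * (1 - A * B * Q) * u
       + (3 + Q - 2 * (A + B) * (1 + Q) + A * B * (1 - Q) + (A + B)\<^sup>2 * Q) * u\<^sup>2)
     / ((A * Q - u) * (B * Q - u) * (1 - A) * (1 - B))"

text \<open>Each summand is a coefficient of the quadratic decomposition times the value of its
  balanced sum, relative to the product common to all three. Clearing denominators leaves the
  polynomial identity \<open>key\<close>: the combined numerator is divisible by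
  \<open>(A - B) (A - B Q) (B - A Q)\<close>, with quotient \<open>P\<close>.\<close>

lemma contig_factor_partial_fractions:
  fixes Q A B u :: "'a::field"
  assumes "A \<noteq> 1" "B \<noteq> 1" "A * Q \<noteq> u" "B * Q \<noteq> u" "A \<noteq> B" "A \<noteq> B * Q" "B \<noteq> A * Q"
  shows "contig_factor Q A B u =
     (1 + Q) / ((A - B * Q) * (B - A * Q)) * ((1 - A) * (1 - B))
     + 1 / ((B - A) * (B - A * Q)) * ((1 - A) * (1 - A * Q)\<^sup>2 * (B - u) / ((A * Q - u) * (1 - B)))
     + 1 / ((A - B) * (A - B * Q)) * ((1 - B) * (1 - B * Q)\<^sup>2 * (A - u) / ((B * Q - u) * (1 - A)))"
proof -
  define d1 d2 d3 f g h k where "d1 = A - B" and "d2 = A - B * Q" and "d3 = B - A * Q"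
    and "f = A * Q - u" and "g = B * Q - u" and "h = 1 - A" and "k = 1 - B"
  note defs = d1_def d2_def d3_def f_def g_def h_def k_def
  define P where "P = Q * (1 - A * B) * (1 - A * B * Q) - (1 + Q) * (2 - A - B) * (1 - A * B * Q) * u
       + (3 + Q - 2 * (A + B) * (1 + Q) + A * B * (1 - Q) + (A + B)\<^sup>2 * Q) * u\<^sup>2"
  have nz: "d1 \<noteq> 0" "d2 \<noteq> 0" "d3 \<noteq> 0" "f \<noteq> 0" "g \<noteq> 0" "h \<noteq> 0" "k \<noteq> 0"
    using assms by (auto simp: defs)
  have key: "P * (d1 * d2 * d3) = (1 + Q) * h\<^sup>2 * k\<^sup>2 * f * g * d1 - h\<^sup>2 * (1 - A * Q)\<^sup>2 * (B - u) * g * d2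
      + k\<^sup>2 * (1 - B * Q)\<^sup>2 * (A - u) * f * d3"
    unfolding P_def defs by algebra
  have "contig_factor Q A B u = P * (d1 * d2 * d3) / (d1 * d2 * d3 * (f * g * h * k))"
    unfolding contig_factor_def P_def[symmetric] f_def[symmetric] g_def[symmetric]
      h_def[symmetric] k_def[symmetric] using nz by simp
  also have "\<dots> = (1 + Q) / (d2 * d3) * (h * k) + 1 / (- d1 * d3) * (h * (1 - A * Q)\<^sup>2 * (B - u) / (f * k))
      + 1 / (d1 * d2) * (k * (1 - B * Q)\<^sup>2 * (A - u) / (g * h))"
  proof -
    have "(x - y + z) / w = x / w - y / w + z / w" for x y z w :: 'a
      by (simp add: add_divide_distrib diff_divide_distrib)
    then show ?thesis unfolding key using nz by (simp add: power2_eq_square mult_ac)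
  qed
  finally show ?thesis unfolding defs by simp
qed

text \<open>Saalschuetz gives \<open>(1/(A Q); Q)_N\<close> and \<open>(Q/B; Q)_N\<close> here.
  Moving both to \<open>(1/A; Q)_N\<close> and \<open>(1/B; Q)_N\<close>, the factorials shared with
  the other sums, costs one rational factor each. The left-hand prefactor is the constant from
  \<open>(1 - A x) (1 - A Q x) (A; Q)_k\<close>.\<close>

lemma saal_sum_double_shift:
  fixes Q A B :: "'a::field"
  assumes "Q \<noteq> 0" "\<And>i. Q * Q ^ i \<noteq> 1" "A \<noteq> 0" "B \<noteq> 0" "B \<noteq> 1" "A * Q \<noteq> Q ^ N"
    and "\<And>i. A * B * Q ^ i \<noteq> 1" "\<And>i. A * B \<noteq> Q ^ i"
  shows "(1 - A) * (1 - A * Q) * (\<Sum>k\<le>N. saal_term Q (A * Q\<^sup>2) B (1 / Q ^ N) Q (A * B * Q\<^sup>2 / Q ^ N) k) =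
    qpoch (1 / A) Q N * qpoch (1 / B) Q N / (qpoch Q Q N * qpoch (1 / (A * B * Q)) Q N) *
    ((1 - A) * (1 - A * Q)\<^sup>2 * (B - Q ^ N) / ((A * Q - Q ^ N) * (1 - B)))"
proof -
  have "A * Q\<^sup>2 * B * Q ^ i \<noteq> Q" for i
    using assms(7)[of "Suc i"] assms(1) by (simp add: power2_eq_square mult_ac)
  moreover have "A * Q\<^sup>2 * B \<noteq> Q * Q ^ i" for i
    using assms(7)[of 1] assms(8)[of "i - 1"] assms(1) by (cases i) (auto simp: power2_eq_square mult_ac)
  moreover have "A * Q\<^sup>2 * B * Q / (Q * Q ^ N) = A * B * Q\<^sup>2 / Q ^ N" "Q / (A * Q\<^sup>2) = 1 / (A * Q)"
    "Q / (A * Q\<^sup>2 * B) = 1 / (A * B * Q)" using assms(1) by (simp_all add: power2_eq_square)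
  ultimately have S: "(\<Sum>k\<le>N. saal_term Q (A * Q\<^sup>2) B (1 / Q ^ N) Q (A * B * Q\<^sup>2 / Q ^ N) k) =
    qpoch (1 / (A * Q)) Q N * qpoch (Q / B) Q N / (qpoch Q Q N * qpoch (1 / (A * B * Q)) Q N)"
    using q_saalschuetz[of Q "A * Q\<^sup>2" B Q N] assms by (simp add: mult_ac)
  have 1: "qpoch (1 / (A * Q)) Q N = (A * Q - 1) * qpoch (1 / A) Q N / (A * Q - Q ^ N)"
    using qpoch_eq_shift[of "1 / (A * Q)" Q N] assms(1,3,6)
    by (simp add: divide_simps)
  have 2: "qpoch (Q / B) Q N = (B - Q ^ N) * qpoch (1 / B) Q N / (B - 1)"
    using qpoch_shift[of "1 / B" Q N] assms(4,5) by (simp add: divide_simps mult_ac)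
  have 3: "qpoch (1 / (A * Q)) Q N = - ((1 - A * Q) * qpoch (1 / A) Q N / (A * Q - Q ^ N))"
    unfolding 1 by (metis minus_diff_eq minus_divide_left minus_mult_left)
  have 4: "qpoch (Q / B) Q N = - ((B - Q ^ N) * qpoch (1 / B) Q N / (1 - B))"
    unfolding 2 by (metis minus_diff_eq minus_divide_right)
  show ?thesis unfolding S 3 4 by (simp add: power2_eq_square mult_ac)
qed

text \<open>The conditions \<open>ne\<close> keep the coefficients of the decomposition finite. The
  conditions \<open>prod\<close> say that \<open>A B\<close> is not an integer power of
  \<open>Q\<close>; as all three sums have upper product \<open>A B Q^2\<close> and
  \<open>D = Q\<close>, this is the nonvanishing condition of \<open>q_saalschuetz\<close> for each
  of them.\<close>

lemma contiguous_saal_sum: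
  fixes Q A B :: "'a::field"
  assumes Q: "Q \<noteq> 0" "\<And>i. Q * Q ^ i \<noteq> 1" and AB: "A \<noteq> 0" "B \<noteq> 0" "A \<noteq> 1" "B \<noteq> 1"
    and N: "A * Q \<noteq> Q ^ N" "B * Q \<noteq> Q ^ N" and ne: "A \<noteq> B" "A \<noteq> B * Q" "B \<noteq> A * Q"
    and prod: "\<And>i. A * B * Q ^ i \<noteq> 1" "\<And>i. A * B \<noteq> Q ^ i"
  shows "(\<Sum>k\<le>N. qpoch A Q k * qpoch B Q k * qpoch (1 / Q ^ N) Q k /
            ((qpoch Q Q k)\<^sup>2 * qpoch (A * B * Q\<^sup>2 / Q ^ N) Q k) * Q ^ (3 * k)) =
    qpoch (1 / A) Q N * qpoch (1 / B) Q N / (qpoch Q Q N * qpoch (1 / (A * B * Q)) Q N) *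
    contig_factor Q A B (Q ^ N)"
proof -
  define E where "E = A * B * Q\<^sup>2 / Q ^ N"
  define V where "V = qpoch (1 / A) Q N * qpoch (1 / B) Q N / (qpoch Q Q N * qpoch (1 / (A * B * Q)) Q N)"
  \<comment> \<open>At \<open>x = 1/A\<close> only the last basis element survives, which determines
    \<gamma>; at \<open>x = 1/B\<close> only the middle one, which determines \<beta>. The constant
    term then forces \<open>\<alpha> = - \<beta> - \<gamma>\<close>.\<close>
  define \<alpha> where "\<alpha> = (1 + Q) / ((A - B * Q) * (B - A * Q))"
  define \<beta> where "\<beta> = 1 / ((B - A) * (B - A * Q))"
  define \<gamma> where "\<gamma> = 1 / ((A - B) * (A - B * Q))"
  let ?s1 = "saal_term Q (A * Q) (B * Q) (1 / Q ^ N) Q E"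
  let ?s2 = "saal_term Q (A * Q\<^sup>2) B (1 / Q ^ N) Q E"
  let ?s3 = "saal_term Q (B * Q\<^sup>2) A (1 / Q ^ N) Q E"
  have nz: "A - B \<noteq> 0" "A - B * Q \<noteq> 0" "B - A * Q \<noteq> 0" "B - A \<noteq> 0" using ne by auto
  have quad: "x\<^sup>2 = \<alpha> * ((1 - A * x) * (1 - B * x)) + \<beta> * ((1 - A * x) * (1 - A * Q * x))
     + \<gamma> * ((1 - B * x) * (1 - B * Q * x))" for x
  proof -
    have s: "\<alpha> = - \<beta> - \<gamma>"
      unfolding \<alpha>_def \<beta>_def \<gamma>_def using nz by (simp add: divide_simps) (simp add: algebra_simps)
    have "\<beta> * (B - A * Q) = - (1 / (A - B))" "\<gamma> * (A - B * Q) = 1 / (A - B)" "1 / (A - B) * (A - B) = 1"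
      using nz by (simp_all add: \<beta>_def \<gamma>_def minus_divide_right)
    with s show ?thesis by algebra
  qed
  have term_eq: "qpoch A Q k * qpoch B Q k * qpoch (1 / Q ^ N) Q k / ((qpoch Q Q k)\<^sup>2 * qpoch E Q k) * Q ^ (3 * k) =
     \<alpha> * ((1 - A) * (1 - B) * ?s1 k) + \<beta> * ((1 - A) * (1 - A * Q) * ?s2 k) + \<gamma> * ((1 - B) * (1 - B * Q) * ?s3 k)" for k
  proof -
    define x where "x = Q ^ k"
    define w where "w = qpoch (1 / Q ^ N) Q k * x / (qpoch Q Q k * qpoch Q Q k * qpoch E Q k)"
    have sh: "(1 - c) * qpoch (c * Q) Q k = qpoch c Q k * (1 - c * x)" for c
      unfolding x_def by (rule qpoch_shift)
    have sh2: "(1 - c) * (1 - c * Q) * qpoch (c * Q\<^sup>2) Q k = qpoch c Q k * ((1 - c * x) * (1 - c * Q * x))" for c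
    proof -
      have "(1 - c) * (1 - c * Q) * qpoch (c * Q\<^sup>2) Q k = (1 - c) * ((1 - c * Q) * qpoch (c * Q * Q) Q k)"
        by (simp add: power2_eq_square mult.assoc)
      also have "\<dots> = (1 - c) * qpoch (c * Q) Q k * (1 - c * Q * x)" by (subst sh) (rule mult.assoc[symmetric])
      finally show ?thesis by (simp only: sh mult.assoc)
    qed
    have 1: "(1 - A) * (1 - B) * ?s1 k = qpoch A Q k * qpoch B Q k * w * ((1 - A * x) * (1 - B * x))"
    proof -
      have "(1 - A) * (1 - B) * ?s1 k = ((1 - A) * qpoch (A * Q) Q k) * ((1 - B) * qpoch (B * Q) Q k) * w"
        by (simp add: saal_term_def w_def x_def mult_ac)
      then show ?thesis unfolding sh by (simp only: mult_ac)
    qed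
    have 2: "(1 - A) * (1 - A * Q) * ?s2 k = qpoch A Q k * qpoch B Q k * w * ((1 - A * x) * (1 - A * Q * x))"
    proof -
      have "(1 - A) * (1 - A * Q) * ?s2 k = ((1 - A) * (1 - A * Q) * qpoch (A * Q\<^sup>2) Q k) * qpoch B Q k * w"
        by (simp add: saal_term_def w_def x_def mult_ac)
      then show ?thesis unfolding sh2 by (simp only: mult_ac)
    qed
    have 3: "(1 - B) * (1 - B * Q) * ?s3 k = qpoch A Q k * qpoch B Q k * w * ((1 - B * x) * (1 - B * Q * x))"
    proof -
      have "(1 - B) * (1 - B * Q) * ?s3 k = ((1 - B) * (1 - B * Q) * qpoch (B * Q\<^sup>2) Q k) * qpoch A Q k * w"
        by (simp add: saal_term_def w_def x_def mult_ac)
      then show ?thesis unfolding sh2 by (simp only: mult_ac)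
    qed
    have "qpoch A Q k * qpoch B Q k * qpoch (1 / Q ^ N) Q k / ((qpoch Q Q k)\<^sup>2 * qpoch E Q k) * Q ^ (3 * k) =
       qpoch A Q k * qpoch B Q k * w * x\<^sup>2"
    proof -
      have "Q ^ (3 * k) = x * x\<^sup>2" by (simp add: x_def power_mult power_commutes flip: power_mult power_add)
      then show ?thesis by (simp add: w_def power2_eq_square mult_ac)
    qed
    also have "\<dots> = qpoch A Q k * qpoch B Q k * w * (\<alpha> * ((1 - A * x) * (1 - B * x)) + \<beta> * ((1 - A * x) * (1 - A * Q * x))
     + \<gamma> * ((1 - B * x) * (1 - B * Q * x)))" by (subst quad) simp
    finally show ?thesis unfolding 1 2 3 by (simp add: distrib_left mult_ac)
  qed
  \<comment> \<open>Shifting \<open>A\<close> and \<open>B\<close> once each gives the common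
    product \<open>V\<close> directly, without a correction factor.\<close>
  have S1: "(1 - A) * (1 - B) * (\<Sum>k\<le>N. ?s1 k) = V * ((1 - A) * (1 - B))"
  proof -
    have "A * Q * (B * Q) * Q ^ i \<noteq> Q" for i
      using prod(1)[of "Suc i"] Q(1) by (simp add: mult_ac)
    moreover have "A * Q * (B * Q) \<noteq> Q * Q ^ i" for i
      using prod(1)[of 1] prod(2)[of "i - 1"] Q(1) by (cases i) (auto simp: mult_ac)
    moreover have "A * Q * (B * Q) * Q / (Q * Q ^ N) = E" "Q / (A * Q) = 1 / A" "Q / (B * Q) = 1 / B"
      "Q / (A * Q * (B * Q)) = 1 / (A * B * Q)"
      using Q(1) by (simp_all add: E_def power2_eq_square mult_ac)
    ultimately have "(\<Sum>k\<le>N. ?s1 k) = V"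
      using q_saalschuetz[of Q "A * Q" "B * Q" Q N] Q AB by (simp add: V_def mult.assoc)
    then show ?thesis by simp
  qed
  have S2: "(1 - A) * (1 - A * Q) * (\<Sum>k\<le>N. ?s2 k) = V * ((1 - A) * (1 - A * Q)\<^sup>2 * (B - Q ^ N) / ((A * Q - Q ^ N) * (1 - B)))"
    unfolding E_def V_def by (rule saal_sum_double_shift) (use Q AB N prod in auto)
  have S3: "(1 - B) * (1 - B * Q) * (\<Sum>k\<le>N. ?s3 k) = V * ((1 - B) * (1 - B * Q)\<^sup>2 * (A - Q ^ N) / ((B * Q - Q ^ N) * (1 - A)))"
    using saal_sum_double_shift[of Q B A N] Q AB N prod
    by (simp add: E_def V_def mult_ac)
  have "(\<Sum>k\<le>N. qpoch A Q k * qpoch B Q k * qpoch (1 / Q ^ N) Q k / ((qpoch Q Q k)\<^sup>2 * qpoch E Q k) * Q ^ (3 * k)) =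
    \<alpha> * ((1 - A) * (1 - B) * (\<Sum>k\<le>N. ?s1 k)) + \<beta> * ((1 - A) * (1 - A * Q) * (\<Sum>k\<le>N. ?s2 k))
    + \<gamma> * ((1 - B) * (1 - B * Q) * (\<Sum>k\<le>N. ?s3 k))"
    unfolding term_eq sum.distrib sum_distrib_left ..
  also have "\<dots> = V * contig_factor Q A B (Q ^ N)"
    unfolding S1 S2 S3 \<alpha>_def \<beta>_def \<gamma>_def
      contig_factor_partial_fractions[OF AB(3,4) N ne] by (simp add: distrib_left mult_ac)
  finally show ?thesis unfolding E_def V_def .
qed

section \<open>Matching the closed form with the given expressions A_n and B\<close>

text \<open>Each factor satisfies \<open>1 - z Q^(j-N) = - z Q^(j-N) (1 - Q^(N-j) / z)\<close>, and
  the product of the \<open>Q^(j+1)\<close> clears the negative powers. It turns factorials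
  containing \<open>Q^-N\<close> into ones independent of \<open>N\<close> in their first
  argument.\<close>

lemma qpoch_reverse:
  fixes z Q :: "'a::field"
  assumes "Q \<noteq> 0" "z \<noteq> 0"
  shows "qpoch (z / Q ^ N) Q N * (\<Prod>j<N. Q ^ Suc j) = (- z) ^ N * qpoch (Q / z) Q N"
proof (induction N)
  case (Suc N)
  have "qpoch (z / Q ^ Suc N) Q (Suc N) * (\<Prod>j<Suc N. Q ^ Suc j) =
      (1 - z / Q ^ Suc N) * Q ^ Suc N * (qpoch (z / Q ^ N) Q N * (\<Prod>j<N. Q ^ Suc j))"
    using assms by (simp add: qpoch_Suc_shift mult_ac)
  also have "(1 - z / Q ^ Suc N) * Q ^ Suc N = - z * (1 - Q / z * Q ^ N)"
    using assms by (simp add: field_simps)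
  also note Suc.IH
  finally show ?case by (simp add: qpoch_Suc mult_ac)
qed simp

text \<open>The product is \<open>Q^(N(N+1)/2)\<close>. Squaring removes the half, and the square is
  what two simultaneous reversals produce.\<close>

lemma prod_power_Suc_square:
  "(\<Prod>j<N. Q ^ Suc j)\<^sup>2 = (Q ^ N) ^ N * (Q::'a::comm_ring_1) ^ N"
proof (induction N)
  case (Suc N)
  have "(\<Prod>j<Suc N. Q ^ Suc j)\<^sup>2 = (\<Prod>j<N. Q ^ Suc j)\<^sup>2 * (Q ^ Suc N)\<^sup>2"
    by (simp add: power_mult_distrib)
  also have "\<dots> = (Q ^ Suc N) ^ Suc N * Q ^ Suc N"
    unfolding Suc.IH by (simp flip: power_mult power_add power_Suc add: algebra_simps power2_eq_square)
  finally show ?case .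
qed simp

text \<open>These are the parameters at the root \<open>b = q^m\<close>, where
  \<open>Q^N = b q\<close>; since \<open>A B Q = q\<close>, the numerator simplifies. The extra
  factor \<open>(1 - b) / (1 - 1/q)\<close> comes from shifting \<open>(1/q; Q)_N\<close> to
  \<open>(q^2; Q)_N\<close>.\<close>

lemma contig_factor_B_fun:
  fixes q a b :: "'a::field"
  assumes "q \<noteq> 0" "a \<noteq> 0" "b \<noteq> 0" "q \<noteq> 1" "q \<noteq> a * b" "a * q \<noteq> b" "q \<noteq> a" "a * q \<noteq> 1"
  shows "contig_factor (q ^ 3) (a / q) (1 / (a * q)) (b * q) * ((1 - b) / (1 - 1 / q)) = b * q * B_fun q a b"
proof -
  \<comment> \<open>With the inverses as variables subject to \<open>q i = 1\<close> and
    \<open>a j = 1\<close>, the identity \<open>key\<close> becomes an ideal membership between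
    polynomials.\<close>
  define i j where "i = inverse q" and "j = inverse a"
  have ij: "q * i = 1" "a * j = 1" using assms by (simp_all add: i_def j_def)
  define \<alpha> \<beta> \<gamma> \<delta> where "\<alpha> = a * q - b" and "\<beta> = q - a * b" and "\<gamma> = q - a" and "\<delta> = a * q - 1"
  note gs = \<alpha>_def \<beta>_def \<gamma>_def \<delta>_def
  have nz: "\<alpha> \<noteq> 0" "\<beta> \<noteq> 0" "\<gamma> \<noteq> 0" "\<delta> \<noteq> 0" "q - 1 \<noteq> 0" using assms by (auto simp: gs)
  define X1 where "X1 = 1 - q - b * (inverse (q ^ 2) + q - a - 1 / a)"
  define X2 where "X2 = 1 - inverse (q ^ 2) - b * (2 * q - a - 1 / a)"
  define P where "P = q ^ 3 * (1 - a / q * (1 / (a * q))) * (1 - a / q * (1 / (a * q)) * q ^ 3)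
     - (1 + q ^ 3) * (2 - a / q - 1 / (a * q)) * (1 - a / q * (1 / (a * q)) * q ^ 3) * (b * q)
     + (3 + q ^ 3 - 2 * (a / q + 1 / (a * q)) * (1 + q ^ 3) + a / q * (1 / (a * q)) * (1 - q ^ 3)
         + (a / q + 1 / (a * q))\<^sup>2 * q ^ 3) * (b * q)\<^sup>2"
  have X1: "X1 = 1 - q - b * (i ^ 2 + q - a - j)"
    by (simp add: X1_def i_def j_def field_simps)
  have X2: "X2 = 1 - i ^ 2 - b * (2 * q - a - j)"
    by (simp add: X2_def i_def j_def field_simps)
  have P: "P = q ^ 3 * (1 - i ^ 2) * (1 - q)
     - (1 + q ^ 3) * (2 - a * i - j * i) * (1 - q) * (b * q)
     + (3 + q ^ 3 - 2 * (a * i + j * i) * (1 + q ^ 3) + i ^ 2 * (1 - q ^ 3)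
         + (a * i + j * i)\<^sup>2 * q ^ 3) * (b * q)\<^sup>2"
  proof -
    have "a / q * (1 / (a * q)) = i ^ 2" "a / q * (1 / (a * q)) * q ^ 3 = q"
      using assms by (simp_all add: i_def field_simps power2_eq_square power3_eq_cube)
    moreover have "a / q = a * i" "1 / (a * q) = j * i"
      by (simp_all add: i_def j_def field_simps)
    ultimately show ?thesis unfolding P_def by simp
  qed
  \<comment> \<open>The numerator splits along the factorization
    \<open>(\<alpha> \<beta>) (\<gamma> \<delta>)\<close> of the denominator; the two parts yield
    the two fractions of \<open>B_fun\<close>.\<close>
  have key: "a * P * (1 - b) = - (b * q * (1 - b * q) * X1 * (\<gamma> * \<delta>)) - q * (q - 1) * X2 * (\<alpha> * \<beta>)"
    unfolding P X1 X2 gs using ij by algebra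
  have d: "(a / q * q ^ 3 - b * q) * (1 / (a * q) * q ^ 3 - b * q) * (1 - a / q) * (1 - 1 / (a * q)) = \<alpha> * \<beta> * \<gamma> * \<delta> / a ^ 2"
  proof -
    have "a / q * q ^ 3 - b * q = q * \<alpha>" "1 / (a * q) * q ^ 3 - b * q = q * \<beta> / a" "1 - a / q = \<gamma> / q" "1 - 1 / (a * q) = \<delta> / (a * q)"
      using assms by (simp_all add: gs field_simps power3_eq_cube)
    then show ?thesis using assms(1,2) by (simp add: power2_eq_square)
  qed
  have "contig_factor (q ^ 3) (a / q) (1 / (a * q)) (b * q) * ((1 - b) / (1 - 1 / q)) =
     a * q * (a * P * (1 - b)) / ((q - 1) * (\<alpha> * \<beta> * \<gamma> * \<delta>))"
  proof -
    have "1 - 1 / q = (q - 1) / q" using assms by (simp add: field_simps)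
    then show ?thesis unfolding contig_factor_def P_def[symmetric] d by (simp add: power2_eq_square mult_ac)
  qed
  also have "\<dots> = b * q * (a * q * (1 - b * q) * X1 / (- (q - 1) * (\<alpha> * \<beta>)) - a * q * X2 / (b * (\<gamma> * \<delta>)))"
  proof -
    have "a * q * (- (b * q * y * X1 * (\<gamma> * \<delta>)) - q * r * X2 * (\<alpha> * \<beta>)) / (r * (\<alpha> * \<beta> * \<gamma> * \<delta>)) =
      b * q * (a * q * y * X1 / (- r * (\<alpha> * \<beta>)) - a * q * X2 / (b * (\<gamma> * \<delta>)))" if "r \<noteq> 0" for r y
      using nz(1-4) assms(1-3) that by (simp add: divide_simps) (simp add: algebra_simps)
    from this[OF nz(5)] show ?thesis unfolding key .
  qed
  also have "a * q * (1 - b * q) * X1 / (- (q - 1) * (\<alpha> * \<beta>)) = (1 - b * q) * X1 / (q * (1 - q) * (1 - a * b / q) * (1 - b / (a * q)))"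
  proof -
    have "1 - q = - (q - 1)" "1 - a * b / q = \<beta> / q" "1 - b / (a * q) = \<alpha> / (a * q)"
      using assms by (simp_all add: gs field_simps)
    then show ?thesis using assms(1,2) by (simp add: mult_ac)
  qed
  also have "a * q * X2 / (b * (\<gamma> * \<delta>)) = X2 / (b * q * (1 - a * inverse q) * (1 - inverse q / a))"
  proof -
    have "1 - a * inverse q = \<gamma> / q" "1 - inverse q / a = \<delta> / (a * q)"
      using assms by (simp_all add: gs field_simps)
    then show ?thesis using assms(1,2) by (simp add: mult_ac)
  qed
  finally show ?thesis by (simp add: B_fun_def X1_def X2_def)
qed

text \<open>Here \<open>w\<close> is \<open>q^m\<close> and \<open>Q^N = w q\<close>. The factor
  \<open>A Q - Q^N\<close> equals \<open>w q (q - 1)\<close>, which is the origin of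
  \<open>1 - q\<close> in the denominator of A_n. The extra factor on the left comes from rewriting
  the quotient of factorials in \<open>specialization_a\<close>.\<close>

lemma contig_factor_A_fun:
  fixes q w b :: "'a::field"
  assumes "q \<noteq> 0" "w \<noteq> 0" "b \<noteq> 0" "q \<noteq> 1" "q \<noteq> w * b" "w * q \<noteq> b" "q \<noteq> w" "b * q \<noteq> 1"
  shows "contig_factor (q ^ 3) (w / q) (1 / (q * b)) (w * q) * (w * q * (1 - 1 / b) / (1 - w * q / b)) =
     b * (1 - w * q) * (w * q ^ 2 / b - q + w / q * (1 + q ^ 3 - w * q ^ 2 - q ^ 2 / b))
       / ((1 - q) * (1 - b * (w / q)) * (1 - w * q / b))
     - (1 - w / q ^ 2 / b - w * q * (2 - w / q - inverse q / b)) / ((1 - w / q) * (1 - inverse q / b))"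
proof -
  define i j where "i = inverse q" and "j = inverse b"
  have ij: "q * i = 1" "b * j = 1" using assms by (simp_all add: i_def j_def)
  define \<alpha> \<beta> \<gamma> \<delta> where "\<alpha> = b - w * q" and "\<beta> = q - w * b" and "\<gamma> = q - w" and "\<delta> = b * q - 1"
  note gs = \<alpha>_def \<beta>_def \<gamma>_def \<delta>_def
  have nz: "\<alpha> \<noteq> 0" "\<beta> \<noteq> 0" "\<gamma> \<noteq> 0" "\<delta> \<noteq> 0" "q - 1 \<noteq> 0" using assms by (auto simp: gs)
  define Y1 where "Y1 = w * q ^ 2 / b - q + w / q * (1 + q ^ 3 - w * q ^ 2 - q ^ 2 / b)"
  define Y2 where "Y2 = 1 - w / q ^ 2 / b - w * q * (2 - w / q - inverse q / b)"
  define P where "P = q ^ 3 * (1 - w / q * (1 / (q * b))) * (1 - w / q * (1 / (q * b)) * q ^ 3)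
     - (1 + q ^ 3) * (2 - w / q - 1 / (q * b)) * (1 - w / q * (1 / (q * b)) * q ^ 3) * (w * q)
     + (3 + q ^ 3 - 2 * (w / q + 1 / (q * b)) * (1 + q ^ 3) + w / q * (1 / (q * b)) * (1 - q ^ 3)
         + (w / q + 1 / (q * b))\<^sup>2 * q ^ 3) * (w * q)\<^sup>2"
  have Y1: "Y1 = w * q ^ 2 * j - q + w * i * (1 + q ^ 3 - w * q ^ 2 - q ^ 2 * j)"
    by (simp add: Y1_def i_def j_def divide_inverse)
  have Y2: "Y2 = 1 - w * i ^ 2 * j - w * q * (2 - w * i - i * j)"
    by (simp add: Y2_def i_def j_def divide_inverse power_inverse)
  have P: "P = q ^ 3 * (1 - w * i ^ 2 * j) * (1 - w * q * j)
     - (1 + q ^ 3) * (2 - w * i - i * j) * (1 - w * q * j) * (w * q)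
     + (3 + q ^ 3 - 2 * (w * i + i * j) * (1 + q ^ 3) + w * i ^ 2 * j * (1 - q ^ 3)
         + (w * i + i * j)\<^sup>2 * q ^ 3) * (w * q)\<^sup>2"
  proof -
    have 1: "w / q * (1 / (q * b)) = w * i ^ 2 * j" "w * i ^ 2 * j * q ^ 3 = w * q * j"
      using assms by (simp_all add: i_def j_def field_simps power2_eq_square power3_eq_cube)
    have 2: "w / q = w * i" "1 / (q * b) = i * j"
      by (simp_all add: i_def j_def field_simps)
    show ?thesis unfolding P_def 1 unfolding 2 ..
  qed
  have key: "b * P * (b - 1) = - (b * (1 - w * q) * Y1 * (\<gamma> * \<delta>)) - q * (q - 1) * Y2 * (\<alpha> * \<beta>)"
    unfolding P Y1 Y2 gs using ij by algebra
  have d: "(w / q * q ^ 3 - w * q) * (1 / (q * b) * q ^ 3 - w * q) * (1 - w / q) * (1 - 1 / (q * b)) =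
     w * (q - 1) * \<beta> * \<gamma> * \<delta> / b ^ 2"
  proof -
    have "w / q * q ^ 3 - w * q = w * q * (q - 1)" "1 / (q * b) * q ^ 3 - w * q = q * \<beta> / b"
      "1 - w / q = \<gamma> / q" "1 - 1 / (q * b) = \<delta> / (b * q)"
      using assms by (simp_all add: gs field_simps power3_eq_cube)
    then show ?thesis using assms(1,3) by (simp add: power2_eq_square)
  qed
  have e: "1 - w * q / b = \<alpha> / b" "1 - b * (w / q) = \<beta> / q" "1 - w / q = \<gamma> / q"
    "1 - inverse q / b = \<delta> / (b * q)" "1 - 1 / b = (b - 1) / b"
    using assms by (simp_all add: gs field_simps)
  have "contig_factor (q ^ 3) (w / q) (1 / (q * b)) (w * q) * (w * q * (1 - 1 / b) / (1 - w * q / b)) =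
     b * q * (b * P * (b - 1)) / ((q - 1) * (\<alpha> * \<beta> * \<gamma> * \<delta>))"
    unfolding contig_factor_def P_def[symmetric] d unfolding e(1,5) using assms(2,3) by (simp add: power2_eq_square mult_ac)
  also have "\<dots> = b\<^sup>2 * q * (1 - w * q) * Y1 / (- (q - 1) * (\<alpha> * \<beta>)) - b * q\<^sup>2 * Y2 / (\<gamma> * \<delta>)"
  proof -
    have "b * q * (- (b * y * Y1 * (\<gamma> * \<delta>)) - q * r * Y2 * (\<alpha> * \<beta>)) / (r * (\<alpha> * \<beta> * \<gamma> * \<delta>)) =
      b\<^sup>2 * q * y * Y1 / (- r * (\<alpha> * \<beta>)) - b * q\<^sup>2 * Y2 / (\<gamma> * \<delta>)" if "r \<noteq> 0" for r y
      using nz(1-4) assms(1-3) that by (simp add: divide_simps) (simp add: algebra_simps power2_eq_square)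
    from this[OF nz(5)] show ?thesis unfolding key .
  qed
  finally show ?thesis unfolding Y1_def[symmetric] Y2_def[symmetric] e
    by (simp add: power2_eq_square mult_ac)
qed

section \<open>Evaluation at the roots of the modulus\<close>

text \<open>The exchange swaps the first two upper factorials, so the root \<open>a = q^-m\<close>
  reduces to \<open>a = q^m\<close>.\<close>

lemma lhs_sum_inverse: "lhs_sum q (1 / a) b N = lhs_sum q a b N"
  by (simp add: lhs_sum_def field_simps)

text \<open>The square enters because \<open>a^2\<close> is the quotient \<open>A / B\<close> of the
  two parameters at \<open>b = q^m\<close>, and the poles of the decomposition lie at powers of
  \<open>Q\<close> in this quotient.\<close>

lemma not_power_quotient:
  fixes q a :: "'a::field"
  assumes "\<And>i j. a\<^sup>2 * q ^ i \<noteq> q ^ j"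
  shows "a * q ^ i \<noteq> q ^ j"
proof
  assume "a * q ^ i = q ^ j"
  then have "a\<^sup>2 * q ^ (2 * i) = q ^ (2 * j)" by (metis power_mult power_mult_distrib mult.commute)
  then show False using assms by blast
qed

text \<open>Now \<open>(q^-1/b; q^3)_k\<close> terminates the sum. On the right the first summand
  carries the factor \<open>b - q^m = 0\<close>, and the second prefactor becomes 1.\<close>

lemma specialization_b:
  fixes q a :: "'a::field"
  assumes q: "q \<noteq> 0" "\<And>i j. q ^ i = q ^ j \<longleftrightarrow> i = j"
    and a: "a \<noteq> 0" "\<And>i j. a\<^sup>2 * q ^ i \<noteq> q ^ j"
    and N: "t * n + 1 = 3 * N"
  shows "lhs_sum q a (q ^ (t * n)) N = rhs_expr q a (q ^ (t * n)) t n N"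
proof -
  define b where "b = q ^ (t * n)"
  define Q where "Q = q ^ 3"
  note a1 = not_power_quotient[OF a(2)]
  have N1: "N \<ge> 1" using N by (cases N) auto
  have bq: "b * q = Q ^ N" using N by (simp add: b_def Q_def flip: power_mult power_Suc2)
  have b0: "b \<noteq> 0" and Q0: "Q \<noteq> 0" using q(1) by (simp_all add: b_def Q_def)
  have Qp: "Q ^ i = q ^ (3 * i)" for i by (simp add: Q_def power_mult)
  have q1: "q ^ i \<noteq> 1" if "i > 0" for i using q(2)[of i 0] that by simp
  have Qi: "Q * Q ^ i \<noteq> 1" for i using q1[of "3 * Suc i"] by (simp add: Qp[of "Suc i", simplified])
  define A B where "A = a / q" and "B = 1 / (a * q)"
  have AB: "A * B = 1 / q\<^sup>2" using a(1) by (simp add: A_def B_def power2_eq_square)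
  have "lhs_sum q a b N = (\<Sum>k\<le>N. qpoch A Q k * qpoch B Q k * qpoch (1 / Q ^ N) Q k /
            ((qpoch Q Q k)\<^sup>2 * qpoch (A * B * Q\<^sup>2 / Q ^ N) Q k) * Q ^ (3 * k))"
  proof -
    have 1: "a * inverse q = A" "inverse q / a = B" "q ^ 3 = Q"
      by (simp_all add: A_def B_def Q_def field_simps)
    have 2: "inverse q / b = 1 / Q ^ N" by (simp add: bq[symmetric] field_simps)
    have 3: "Q / b = A * B * Q\<^sup>2 / Q ^ N"
      unfolding bq[symmetric] AB using q(1) b0 by (simp add: Q_def field_simps power2_eq_square power3_eq_cube)
    have 4: "q ^ (9 * k) = Q ^ (3 * k)" for k by (simp add: Qp)
    show ?thesis unfolding lhs_sum_def 1 2 3 4 atMost_atLeast0 ..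
  qed
  also have "\<dots> = qpoch (1 / A) Q N * qpoch (1 / B) Q N / (qpoch Q Q N * qpoch (1 / (A * B * Q)) Q N) *
    contig_factor Q A B (Q ^ N)"
  proof (rule contiguous_saal_sum)
    show "A \<noteq> 0" "B \<noteq> 0" using q(1) a(1) by (simp_all add: A_def B_def)
    show "A \<noteq> 1" "B \<noteq> 1" using q(1) a(1) a1[of 0 1] a1[of 1 0] by (auto simp: A_def B_def field_simps)
    show "A * Q \<noteq> Q ^ N" unfolding Qp[of N] using q(1) a1[of 3 "3 * N + 1"] by (auto simp: A_def Q_def field_simps)
    show "B * Q \<noteq> Q ^ N" unfolding Qp[of N] using q(1) a(1) a1[of "3 * N + 1" 3] by (auto simp: B_def Q_def field_simps)
    show "A \<noteq> B" using q(1) a(1) a(2)[of 0 0] by (auto simp: A_def B_def field_simps power2_eq_square)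
    show "A \<noteq> B * Q" using q(1) a(1) a(2)[of 0 3] by (auto simp: A_def B_def Q_def field_simps power2_eq_square)
    show "B \<noteq> A * Q" using q(1) a(1) a(2)[of 3 0] by (auto simp: A_def B_def Q_def field_simps power2_eq_square)
    \<comment> \<open>As \<open>A B = q^-2\<close>, equality would force
      \<open>3 i = 2\<close>.\<close>
    show "A * B * Q ^ i \<noteq> 1" for i
    proof -
      have "3 * i \<noteq> 2" by presburger
      then show ?thesis using q(1) q(2)[of "3 * i" 2] by (auto simp: AB Qp field_simps)
    qed
    show "A * B \<noteq> Q ^ i" for i
      using q(1) q1[of "3 * i + 2"] by (auto simp: AB Qp field_simps power_add power2_eq_square)
  qed (use Q0 Qi in auto)
  also have "qpoch (1 / (A * B * Q)) Q N = (1 - 1 / q) * qpoch (q\<^sup>2) Q N / (1 - b)"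
  proof -
    have 1: "1 / (A * B * Q) = 1 / q" using q(1) by (simp add: AB Q_def power2_eq_square power3_eq_cube)
    have "1 / q * Q = q\<^sup>2" using q(1) by (simp add: Q_def power2_eq_square power3_eq_cube)
    moreover have "1 / q * Q ^ N = b" using q(1) by (simp flip: bq)
    moreover have "b \<noteq> 1"
    proof -
      have "t * n > 0" using N N1 by linarith
      then show ?thesis unfolding b_def by (rule q1)
    qed
    ultimately show ?thesis unfolding 1 using qpoch_eq_shift[of "1 / q" Q N] by simp
  qed
  also have "1 / A = q / a" by (simp add: A_def)
  also have "1 / B = a * q" by (simp add: B_def)
  also have "qpoch (q / a) Q N * qpoch (a * q) Q N / (qpoch Q Q N * ((1 - 1 / q) * qpoch (q\<^sup>2) Q N / (1 - b))) * contig_factor Q A B (Q ^ N) =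
     qpoch (q / a) Q N * qpoch (a * q) Q N / (qpoch Q Q N * qpoch (q\<^sup>2) Q N) * (contig_factor Q A B (Q ^ N) * ((1 - b) / (1 - 1 / q)))"
    by (simp add: mult_ac)
  also have "contig_factor Q A B (Q ^ N) * ((1 - b) / (1 - 1 / q)) = b * q * B_fun q a b"
    unfolding bq[symmetric] unfolding Q_def A_def B_def
  proof (rule contig_factor_B_fun)
    show "q \<noteq> 1" using q1[of 1] by simp
    show "q \<noteq> a * b" using a1[of "t * n" 1] by (auto simp: b_def)
    show "a * q \<noteq> b" using a1[of 1 "t * n"] by (auto simp: b_def)
    show "q \<noteq> a" "a * q \<noteq> 1" using a1[of 0 1] a1[of 1 0] by auto
  qed (use q a b0 in auto)
  also have "qpoch (q / a) Q N * qpoch (a * q) Q N / (qpoch Q Q N * qpoch (q\<^sup>2) Q N) * (b * q * B_fun q a b) =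
     qpoch (a * q) Q N * qpoch (q / a) Q N / (b ^ N * (qpoch (1 / b) Q N * qpoch (1 / (b * q)) Q N)) * B_fun q a b"
  proof -
    \<comment> \<open>Since \<open>1/b = q Q^-N\<close> and \<open>1/(b q) = Q^-N\<close>, both
      denominators are reversed, each at the cost of \<open>c\<close>. The signs cancel, and
      \<open>c^2 = (b q)^N (b q)\<close> leaves exactly the \<open>b q\<close> contributed by
      \<open>contig_factor_B_fun\<close>.\<close>
    define c where "c = (\<Prod>j<N. Q ^ Suc j)"
    have 1: "qpoch (1 / b) Q N * c = (- q) ^ N * qpoch (q\<^sup>2) Q N"
    proof -
      have "1 / b = q / Q ^ N" using q(1) by (simp flip: bq)
      moreover have "Q / q = q\<^sup>2" using q(1) by (simp add: Q_def power2_eq_square power3_eq_cube)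
      ultimately show ?thesis using qpoch_reverse[OF Q0 q(1), of N] by (simp add: c_def)
    qed
    have 2: "qpoch (1 / (b * q)) Q N * c = (- 1) ^ N * qpoch Q Q N"
      using qpoch_reverse[OF Q0, of 1 N] by (simp add: c_def bq)
    have 3: "c\<^sup>2 = (b * q) ^ N * (b * q)" unfolding c_def prod_power_Suc_square bq ..
    have "(b ^ N * (qpoch (1 / b) Q N * qpoch (1 / (b * q)) Q N)) * c\<^sup>2 =
       b ^ N * (qpoch (1 / b) Q N * c) * (qpoch (1 / (b * q)) Q N * c)" by (simp add: power2_eq_square mult_ac)
    also have "\<dots> = (b * q) ^ N * (qpoch Q Q N * qpoch (q\<^sup>2) Q N)"
    proof -
      have "(- q) ^ N * (- 1) ^ N = q ^ N" by (simp flip: power_mult_distrib)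
      then have "b ^ N * ((- q) ^ N * x) * ((- 1) ^ N * y) = b ^ N * q ^ N * (y * x)" for x y
        by (metis (no_types, opaque_lifting) mult.assoc mult.commute)
      then show ?thesis unfolding 1 2 by (simp add: power_mult_distrib)
    qed
    finally have "b ^ N * (qpoch (1 / b) Q N * qpoch (1 / (b * q)) Q N) * (b * q) = qpoch Q Q N * qpoch (q\<^sup>2) Q N"
      unfolding 3 using b0 q(1) by (simp add: mult.assoc)
    then have "qpoch Q Q N * qpoch (q\<^sup>2) Q N = b ^ N * (qpoch (1 / b) Q N * qpoch (1 / (b * q)) Q N) * (b * q)" ..
    then show ?thesis using b0 q(1) by (simp add: mult_ac)
  qed
  also have "\<dots> = rhs_expr q a b t n N"
  proof -
    have "(a - b) * (1 - a * b) \<noteq> 0" using a1[of 0 "t * n"] a1[of "t * n" 0] by (auto simp: b_def)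
    then have "(1 - a * b) * (a - b) / ((a - b) * (1 - a * b)) = 1" by (simp add: mult.commute)
    then show ?thesis unfolding rhs_expr_def b_def[symmetric] Q_def by simp
  qed
  finally show ?thesis unfolding b_def .
qed

text \<open>This time \<open>(q^-1/a; q^3)_k\<close> terminates the sum and \<open>b\<close> stays
  free. Only A_n with its factorials is stated, without the prefactor, so that the value serves both
  \<open>a = q^m\<close> and \<open>a = q^-m\<close>.\<close>

lemma specialization_a:
  fixes q b :: "'a::field"
  assumes q: "q \<noteq> 0" "\<And>i j. q ^ i = q ^ j \<longleftrightarrow> i = j"
    and b: "b \<noteq> 0" "\<And>i j. b * q ^ i \<noteq> q ^ j"
    and N: "t * n + 1 = 3 * N"
  shows "lhs_sum q (q ^ (t * n)) b N =
    qpoch (b * q) (q ^ 3) N * qpoch q (q ^ 3) N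
      / ((b * q) ^ N * (qpoch (1 / b) (q ^ 3) N * qpoch (q ^ 3) (q ^ 3) N)) * A_fun n q b t"
proof -
  define w where "w = q ^ (t * n)"
  define Q where "Q = q ^ 3"
  have tn: "t * n \<ge> 2" using N by (cases N) auto
  have wq: "w * q = Q ^ N" using N by (simp add: w_def Q_def flip: power_mult power_Suc2)
  have w0: "w \<noteq> 0" and Q0: "Q \<noteq> 0" using q(1) by (simp_all add: w_def Q_def)
  have Qp: "Q ^ i = q ^ (3 * i)" for i by (simp add: Q_def power_mult)
  have q1: "q ^ i \<noteq> 1" if "i > 0" for i using q(2)[of i 0] that by simp
  have Qi: "Q * Q ^ i \<noteq> 1" for i using q1[of "3 * Suc i"] by (simp add: Qp[of "Suc i", simplified])
  define A B where "A = w / q" and "B = 1 / (q * b)"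
  have AB: "A * B = w / (q\<^sup>2 * b)" by (simp add: A_def B_def power2_eq_square)
  have "lhs_sum q w b N = (\<Sum>k\<le>N. qpoch A Q k * qpoch B Q k * qpoch (1 / Q ^ N) Q k /
            ((qpoch Q Q k)\<^sup>2 * qpoch (A * B * Q\<^sup>2 / Q ^ N) Q k) * Q ^ (3 * k))"
  proof -
    have 1: "w * inverse q = A" "inverse q / b = B" "q ^ 3 = Q"
      by (simp_all add: A_def B_def Q_def field_simps)
    have 2: "inverse q / w = 1 / Q ^ N" by (simp add: wq[symmetric] field_simps)
    have 3: "Q / b = A * B * Q\<^sup>2 / Q ^ N"
      unfolding wq[symmetric] AB using q(1) w0 by (simp add: Q_def field_simps power2_eq_square power3_eq_cube)
    have 4: "q ^ (9 * k) = Q ^ (3 * k)" for k by (simp add: Qp)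
    show ?thesis unfolding lhs_sum_def 1 2 3 4 atMost_atLeast0 by (simp add: mult_ac)
  qed
  also have "\<dots> = qpoch (1 / A) Q N * qpoch (1 / B) Q N / (qpoch Q Q N * qpoch (1 / (A * B * Q)) Q N) *
    contig_factor Q A B (Q ^ N)"
  proof (rule contiguous_saal_sum)
    show "A \<noteq> 0" "B \<noteq> 0" using q(1) b(1) w0 by (simp_all add: A_def B_def)
    show "A \<noteq> 1" using q(1) q(2)[of "t * n" 1] tn by (auto simp: A_def w_def)
    show "B \<noteq> 1" using q(1) b(1) b(2)[of 1 0] by (auto simp: B_def field_simps)
    show "A * Q \<noteq> Q ^ N"
      using q(1) q(2)[of "t * n + 3" "t * n + 2"] unfolding wq[symmetric]
      by (auto simp: A_def Q_def w_def field_simps power_add power2_eq_square)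
    show "B * Q \<noteq> Q ^ N" unfolding Qp[of N] using q(1) b(1) b(2)[of "3 * N + 1" 3] by (auto simp: B_def Q_def field_simps)
    show "A \<noteq> B" using q(1) b(1) b(2)[of "t * n" 0] by (auto simp: A_def B_def w_def field_simps)
    show "A \<noteq> B * Q" using q(1) b(1) b(2)[of "t * n" 3] by (auto simp: A_def B_def Q_def w_def field_simps)
    show "B \<noteq> A * Q" using q(1) b(1) b(2)[of "t * n + 3" 0] by (auto simp: A_def B_def Q_def w_def field_simps power_add)
    show "A * B * Q ^ i \<noteq> 1" for i
      using q(1) b(1) b(2)[of 2 "t * n + 3 * i"] by (auto simp: AB Qp w_def field_simps power_add power2_eq_square)
    show "A * B \<noteq> Q ^ i" for i
      using q(1) b(1) b(2)[of "3 * i + 2" "t * n"] by (auto simp: AB Qp w_def field_simps power_add power2_eq_square)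
  qed (use Q0 Qi in auto)
  also have "qpoch (1 / A) Q N * qpoch (1 / B) Q N / (qpoch Q Q N * qpoch (1 / (A * B * Q)) Q N) =
    qpoch (b * q) Q N * qpoch q Q N / ((b * q) ^ N * (qpoch (1 / b) Q N * qpoch Q Q N)) * (w * q * (1 - 1 / b) / (1 - w * q / b))"
  proof -
    define c where "c = (\<Prod>j<N. Q ^ Suc j)"
    have c0: "c \<noteq> 0" using Q0 by (simp add: c_def)
    have e: "1 / A = q\<^sup>2 / Q ^ N" "1 / (A * B * Q) = b / Q ^ N" "1 / B = b * q" "Q / q\<^sup>2 = q"
      using q(1) w0 unfolding wq[symmetric]
      by (simp_all add: A_def B_def Q_def power2_eq_square power3_eq_cube)
    have 1: "qpoch (1 / A) Q N = (- (q\<^sup>2)) ^ N * qpoch q Q N / c"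
      using qpoch_reverse[OF Q0, of "q\<^sup>2" N] q(1) c0 unfolding e c_def[symmetric] by (simp add: field_simps)
    have 2: "qpoch (1 / (A * B * Q)) Q N = (- b) ^ N * qpoch (Q / b) Q N / c"
      using qpoch_reverse[OF Q0 b(1), of N] c0 unfolding e c_def[symmetric] by (simp add: field_simps)
    have 3: "qpoch (Q / b) Q N = qpoch (1 / b) Q N * (1 - w * q / b) / (1 - 1 / b)"
    proof -
      have "1 - 1 / b \<noteq> 0" using b(1) b(2)[of 0 0] by simp
      moreover have "(1 - 1 / b) * qpoch (Q / b) Q N = qpoch (1 / b) Q N * (1 - w * q / b)"
        using qpoch_shift[of "1 / b" Q N] by (simp add: wq)
      ultimately show ?thesis by (metis nonzero_mult_div_cancel_left)
    qed
    \<comment> \<open>The two reversals stand in numerator and denominator, so \<open>c\<close>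
      cancels. The powers of \<open>z\<close> that remain combine through
      \<open>q^2 / b = Q / (b q)\<close> and \<open>Q^N = w q\<close>.\<close>
    have 4: "(- (q\<^sup>2)) ^ N / (- b) ^ N = w * q / (b * q) ^ N"
    proof -
      have "(- (q\<^sup>2)) ^ N / (- b) ^ N = (q\<^sup>2 / b) ^ N" by (simp flip: power_divide)
      also have "q\<^sup>2 / b = Q / (b * q)" using q(1) by (simp add: Q_def power2_eq_square power3_eq_cube)
      finally show ?thesis by (simp add: wq power_divide)
    qed
    have "qpoch (1 / A) Q N * qpoch (1 / B) Q N / (qpoch Q Q N * qpoch (1 / (A * B * Q)) Q N) =
      (- (q\<^sup>2)) ^ N / (- b) ^ N * (qpoch q Q N * qpoch (b * q) Q N / (qpoch Q Q N * qpoch (Q / b) Q N))"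
      unfolding 1 2 e(3) using c0 by (simp add: mult_ac)
    also have "\<dots> = qpoch (b * q) Q N * qpoch q Q N / ((b * q) ^ N * (qpoch (1 / b) Q N * qpoch Q Q N)) * (w * q * (1 - 1 / b) / (1 - w * q / b))"
      unfolding 4 3 by (simp add: mult_ac)
    finally show ?thesis .
  qed
  also have "\<dots> * contig_factor Q A B (Q ^ N) =
    qpoch (b * q) Q N * qpoch q Q N / ((b * q) ^ N * (qpoch (1 / b) Q N * qpoch Q Q N)) *
    (contig_factor Q A B (Q ^ N) * (w * q * (1 - 1 / b) / (1 - w * q / b)))"
    by (simp only: mult_ac)
  also have "contig_factor Q A B (Q ^ N) * (w * q * (1 - 1 / b) / (1 - w * q / b)) = A_fun n q b t"
  proof -
    have "1 \<le> t * n" using tn by linarith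
    then have "q ^ (t * n - 1) = q ^ (t * n) / q ^ 1" by (rule power_diff[OF q(1)])
    moreover have "q ^ (t * n - 2) = q ^ (t * n) / q ^ 2" using tn by (rule power_diff[OF q(1)])
    ultimately have p: "q ^ (t * n + 1) = w * q" "q ^ (t * n + 2) = w * q ^ 2" "q ^ (t * n - 1) = w / q"
      "q ^ (t * n - 2) = w / q ^ 2"
      by (simp_all add: w_def power_add power2_eq_square)
    have "q \<noteq> 1" "q \<noteq> w * b" "w * q \<noteq> b" "q \<noteq> w" "b * q \<noteq> 1"
      using q1[of 1] b(2)[of "t * n" 1] b(2)[of 0 "t * n + 1"] q(2)[of 1 "t * n"] b(2)[of 1 0] tn
      by (auto simp: w_def mult_ac)
    then show ?thesis unfolding A_fun_def p wq[symmetric] unfolding A_def B_def Q_def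
      using contig_factor_A_fun[of q w b] q(1) w0 b(1) by blast
  qed
  finally show ?thesis unfolding w_def Q_def .
qed

lemma specialization_a_pos:
  fixes q b :: "'a::field"
  assumes q: "q \<noteq> 0" "\<And>i j. q ^ i = q ^ j \<longleftrightarrow> i = j"
    and b: "b \<noteq> 0" "\<And>i j. b * q ^ i \<noteq> q ^ j"
    and N: "t * n + 1 = 3 * N"
  shows "lhs_sum q (q ^ (t * n)) b N = rhs_expr q (q ^ (t * n)) b t n N"
proof -
  define w where "w = q ^ (t * n)"
  have "(w - b) * (1 - w * b) \<noteq> 0" using b(2)[of "t * n" 0] b(2)[of 0 "t * n"] by (auto simp: w_def mult.commute)
  moreover have "(b - w) * (w * b - 1 - w ^ 2 + w * w) = (w - b) * (1 - w * b)" by algebra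
  ultimately have "(b - w) * (w * b - 1 - w ^ 2 + w * w) / ((w - b) * (1 - w * b)) = 1" by simp
  then show ?thesis unfolding specialization_a[OF assms] unfolding rhs_expr_def w_def[symmetric] by simp
qed

text \<open>With \<open>a q^m = 1\<close> the factor \<open>a b - 1 - a^2 + a q^m\<close> reduces to
  \<open>a (b - a)\<close>, and \<open>a (b - q^m) = a b - 1\<close>, so the first prefactor is
  again 1. The second summand vanishes through \<open>1 - a q^m\<close>.\<close>

lemma specialization_a_neg:
  fixes q b :: "'a::field"
  assumes q: "q \<noteq> 0" "\<And>i j. q ^ i = q ^ j \<longleftrightarrow> i = j"
    and b: "b \<noteq> 0" "\<And>i j. b * q ^ i \<noteq> q ^ j"
    and N: "t * n + 1 = 3 * N"
  shows "lhs_sum q (1 / q ^ (t * n)) b N = rhs_expr q (1 / q ^ (t * n)) b t n N"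
proof -
  define w where "w = q ^ (t * n)"
  define v where "v = 1 / w"
  have wv: "w * v = 1" using q(1) by (simp add: v_def w_def)
  have "v - b \<noteq> 0" using b(2)[of "t * n" 0] q(1) by (auto simp: w_def v_def field_simps)
  moreover have "1 - v * b \<noteq> 0" using b(2)[of 0 "t * n"] q(1) by (auto simp: w_def v_def field_simps)
  ultimately have "(v - b) * (1 - v * b) \<noteq> 0" by simp
  moreover have "(b - w) * (v * b - 1 - v ^ 2 + v * w) = (v - b) * (1 - v * b)" using wv by algebra
  ultimately have "(b - w) * (v * b - 1 - v ^ 2 + v * w) / ((v - b) * (1 - v * b)) = 1" by simp
  moreover have "1 - v * w = 0" using wv by (simp add: mult.commute)
  ultimately show ?thesis unfolding lhs_sum_inverse specialization_a[OF assms]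
    unfolding rhs_expr_def w_def[symmetric] v_def[symmetric]
    by simp
qed

section \<open>Specialization of rational functions\<close>

text \<open>A ring homomorphism into a field with kernel generated by \<open>p\<close>. It extends
  to the localization at \<open>p\<close>, where congruence modulo \<open>p\<close> becomes equality
  of values.\<close>

locale specialization =
  fixes ev :: "qab_poly \<Rightarrow> 'k::field" and p :: qab_poly
  assumes ev_add: "ev (x + y) = ev x + ev y"
    and ev_mult: "ev (x * y) = ev x * ev y"
    and ev_1 [simp]: "ev 1 = 1"
    and ev_eq_0_iff: "ev x = 0 \<longleftrightarrow> p dvd x"
    and p_nonzero: "p \<noteq> 0"
begin

lemma ev_0 [simp]: "ev 0 = 0"
  by (simp add: ev_eq_0_iff)

lemma ev_uminus: "ev (- x) = - ev x"
  using ev_add[of x "- x"] by (simp add: eq_neg_iff_add_eq_0 add.commute)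

lemma ev_diff: "ev (x - y) = ev x - ev y"
  using ev_add[of x "- y"] by (simp add: ev_uminus)

lemma ev_power: "ev (x ^ k) = ev x ^ k"
  by (induction k) (simp_all add: ev_mult)

lemma prime_elem_p: "prime_elem p"
proof (rule prime_elemI)
  show "\<not> is_unit p" using ev_eq_0_iff[of 1] by simp
  show "p dvd x \<or> p dvd y" if "p dvd x * y" for x y
    using that by (simp add: ev_mult flip: ev_eq_0_iff)
qed (rule p_nonzero)

text \<open>The graph of the extension of \<open>ev\<close> to the localization at \<open>p\<close>.
  As a relation it is built up along the structure of an expression, with a nonvanishing condition
  only at divisions and inverses.\<close>

definition specializes :: "qab_rat \<Rightarrow> 'k \<Rightarrow> bool" where
  "specializes x v \<longleftrightarrow> (\<exists>P D. x = to_fract P / to_fract D \<and> ev D \<noteq> 0 \<and> v = ev P / ev D)"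

lemma specializesI: "x = to_fract P / to_fract D \<Longrightarrow> ev D \<noteq> 0 \<Longrightarrow> v = ev P / ev D \<Longrightarrow> specializes x v"
  by (auto simp: specializes_def)

lemma specializesE:
  assumes "specializes x v"
  obtains P D where "x = to_fract P / to_fract D" "ev D \<noteq> 0" "v = ev P / ev D" "D \<noteq> 0"
  using assms unfolding specializes_def by (metis ev_0)

lemma specializes_to_fract: "specializes (to_fract P) (ev P)"
  by (rule specializesI[of _ P 1]) simp_all

lemma specializes_1: "specializes 1 1"
  using specializes_to_fract[of 1] by simp

lemma specializes_add:
  assumes "specializes x v" "specializes y w"
  shows "specializes (x + y) (v + w)"
proof -
  obtain P D where 1: "x = to_fract P / to_fract D" "ev D \<noteq> 0" "v = ev P / ev D" "D \<noteq> 0"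
    using assms(1) by (rule specializesE)
  obtain P' D' where 2: "y = to_fract P' / to_fract D'" "ev D' \<noteq> 0" "w = ev P' / ev D'" "D' \<noteq> 0"
    using assms(2) by (rule specializesE)
  show ?thesis
    by (rule specializesI[of _ "P * D' + P' * D" "D * D'"])
       (use 1 2 in \<open>simp_all add: ev_add ev_mult field_simps\<close>)
qed

lemma specializes_uminus:
  assumes "specializes x v"
  shows "specializes (- x) (- v)"
proof -
  obtain P D where 1: "x = to_fract P / to_fract D" "ev D \<noteq> 0" "v = ev P / ev D" "D \<noteq> 0"
    using assms by (rule specializesE)
  show ?thesis by (rule specializesI[of _ "- P" D]) (use 1 in \<open>simp_all add: ev_uminus\<close>)
qed

lemma specializes_diff: "specializes x v \<Longrightarrow> specializes y w \<Longrightarrow> specializes (x - y) (v - w)"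
  using specializes_add[of x v "- y" "- w"] specializes_uminus[of y w] by simp

lemma specializes_mult:
  assumes "specializes x v" "specializes y w"
  shows "specializes (x * y) (v * w)"
proof -
  obtain P D where 1: "x = to_fract P / to_fract D" "ev D \<noteq> 0" "v = ev P / ev D" "D \<noteq> 0"
    using assms(1) by (rule specializesE)
  obtain P' D' where 2: "y = to_fract P' / to_fract D'" "ev D' \<noteq> 0" "w = ev P' / ev D'" "D' \<noteq> 0"
    using assms(2) by (rule specializesE)
  show ?thesis
    by (rule specializesI[of _ "P * P'" "D * D'"]) (use 1 2 in \<open>simp_all add: ev_mult\<close>)
qed

lemma specializes_inverse:
  assumes "specializes x v" "v \<noteq> 0"
  shows "specializes (inverse x) (inverse v)"
proof -
  obtain P D where 1: "x = to_fract P / to_fract D" "ev D \<noteq> 0" "v = ev P / ev D" "D \<noteq> 0"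
    using assms(1) by (rule specializesE)
  show ?thesis by (rule specializesI[of _ D P]) (use 1 assms(2) in simp_all)
qed

lemma specializes_divide: "specializes x v \<Longrightarrow> specializes y w \<Longrightarrow> w \<noteq> 0 \<Longrightarrow> specializes (x / y) (v / w)"
  unfolding divide_inverse by (intro specializes_mult specializes_inverse)

lemma specializes_power: "specializes x v \<Longrightarrow> specializes (x ^ k) (v ^ k)"
  by (induction k) (simp_all add: specializes_1 specializes_mult)

lemma specializes_2: "specializes 2 2"
  using specializes_add[OF specializes_1 specializes_1] by simp

lemma specializes_sum:
  "(\<And>k. k \<in> A \<Longrightarrow> specializes (f k) (g k)) \<Longrightarrow> specializes (\<Sum>k\<in>A. f k) (\<Sum>k\<in>A. g k)"
  using specializes_to_fract[of 0]
  by (induction A rule: infinite_finite_induct) (simp_all add: specializes_add)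

lemma specializes_qpoch: "specializes x v \<Longrightarrow> specializes y w \<Longrightarrow> specializes (qpoch x y k) (qpoch v w k)"
proof (induction k)
  case (Suc k)
  then show ?case unfolding qpoch_def prod.lessThan_Suc
    by (intro specializes_mult specializes_diff specializes_1 specializes_power)
qed (simp add: qpoch_def specializes_1)

lemmas specializes_intros = specializes_1 specializes_2 specializes_add specializes_diff specializes_mult
  specializes_divide specializes_inverse specializes_power specializes_qpoch specializes_sum

text \<open>The reduced denominator divides every denominator, in particular one on which
  \<open>ev\<close> does not vanish; hence the prime \<open>p\<close> does not divide it.\<close>

lemma coprime_snd_quot_of_fract:
  assumes "specializes x v"
  shows "coprime (snd (quot_of_fract x)) p"
proof -
  define c d where "c = fst (quot_of_fract x)" and "d = snd (quot_of_fract x)"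
  obtain P D where 1: "x = to_fract P / to_fract D" "ev D \<noteq> 0" "v = ev P / ev D" "D \<noteq> 0"
    using assms by (rule specializesE)
  have "x = to_fract c / to_fract d" unfolding c_def d_def Fract_conv_to_fract[symmetric] by simp
  moreover have "d \<noteq> 0" by (simp add: d_def)
  ultimately have "to_fract (c * D) = to_fract (P * d)"
    using 1(1,4) by (simp add: field_simps)
  then have "c * D = P * d" by (simp only: to_fract_eq_iff)
  then have "d dvd c * D" by simp
  moreover have "coprime d c"
    using coprime_quot_of_fract[of x] by (simp add: c_def d_def coprime_commute)
  ultimately have "d dvd D" by (simp add: coprime_dvd_mult_right_iff)
  then have "\<not> p dvd d" using 1(2) by (meson dvd_trans ev_eq_0_iff)
  then show ?thesis
    using prime_elem_imp_coprime[OF prime_elem_p] by (metis d_def coprime_commute)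
qed

lemma p_dvd_fst_quot_of_fract_diff:
  assumes "specializes x v" "specializes y v"
  shows "p dvd fst (quot_of_fract (x - y))"
proof -
  define c d where "c = fst (quot_of_fract (x - y))" and "d = snd (quot_of_fract (x - y))"
  have "specializes (x - y) 0" using specializes_diff[OF assms] by simp
  then obtain P D where 1: "x - y = to_fract P / to_fract D" "ev D \<noteq> 0" "0 = ev P / ev D" "D \<noteq> 0"
    by (rule specializesE)
  have "x - y = to_fract c / to_fract d" unfolding c_def d_def Fract_conv_to_fract[symmetric] by simp
  moreover have "d \<noteq> 0" by (simp add: d_def)
  ultimately have "to_fract (c * D) = to_fract (P * d)"
    using 1(1,4) by (simp add: field_simps)
  then have "c * D = P * d" by (simp only: to_fract_eq_iff)
  then have "ev c * ev D = ev P * ev d" by (simp flip: ev_mult)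
  then have "ev c = 0" using 1(2,3) by simp
  then show ?thesis by (simp add: ev_eq_0_iff c_def)
qed

lemma coprime_p_iff: "coprime p x \<longleftrightarrow> ev x \<noteq> 0"
  unfolding ev_eq_0_iff using prime_elem_imp_coprime[OF prime_elem_p] prime_elem_p
  by (meson coprime_absorb_left prime_elem_not_unit)

end

text \<open>No denominator on either side vanishes.\<close>

definition nonsingular :: "'a::field \<Rightarrow> 'a \<Rightarrow> 'a \<Rightarrow> nat \<Rightarrow> nat \<Rightarrow> bool" where
  "nonsingular q a b m N \<longleftrightarrow>
     q \<noteq> 0 \<and> a \<noteq> 0 \<and> b \<noteq> 0 \<and> (\<forall>i. q ^ Suc i \<noteq> 1) \<and> (\<forall>i. b \<noteq> q ^ (3 * i)) \<and> (\<forall>i<N. b * q \<noteq> q ^ (3 * i))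
     \<and> b * q \<noteq> 1 \<and> b * q ^ (m - 1) \<noteq> 1 \<and> b \<noteq> q ^ (m + 1) \<and> q ^ (m - 1) \<noteq> 1 \<and> a \<noteq> b \<and> a * b \<noteq> 1
     \<and> a * b \<noteq> q \<and> b \<noteq> a * q \<and> a \<noteq> q \<and> a * q \<noteq> 1"

context specialization
begin

context
  fixes q a b :: 'k and m N :: nat
  assumes q: "specializes q_var q" and a: "specializes a_var a" and b: "specializes b_var b"
    and ns: "nonsingular q a b m N"
begin

lemma nonsingular_qpoch:
  "qpoch (q ^ 3) (q ^ 3) k \<noteq> 0" "qpoch (q ^ 3 / b) (q ^ 3) k \<noteq> 0" "qpoch (1 / b) (q ^ 3) k \<noteq> 0"
  "qpoch (1 / (b * q)) (q ^ 3) N \<noteq> 0"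
proof -
  have Q: "q ^ 3 * q ^ (3 * j) = q ^ (3 * Suc j)" "(q ^ 3) ^ j = q ^ (3 * j)" for j
    by (simp_all add: power_mult power_add)
  have 1: "q ^ (3 * Suc j) \<noteq> 1" for j
  proof -
    have "q ^ Suc (3 * j + 2) \<noteq> 1" using ns unfolding nonsingular_def by blast
    moreover have "Suc (3 * j + 2) = 3 * Suc j" by simp
    ultimately show ?thesis by metis
  qed
  have 2: "b \<noteq> q ^ (3 * i)" "b \<noteq> 0" for i using ns by (auto simp: nonsingular_def)
  have 3: "b * q \<noteq> q ^ (3 * i)" if "i < N" for i using ns that by (auto simp: nonsingular_def)
  have 4: "b * q \<noteq> 0" using ns by (auto simp: nonsingular_def)
  show "qpoch (q ^ 3) (q ^ 3) k \<noteq> 0" unfolding qpoch_eq_0_iff Q using 1 by blast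
  show "qpoch (q ^ 3 / b) (q ^ 3) k \<noteq> 0" unfolding qpoch_eq_0_iff times_divide_eq_left Q using 2
    by (metis divide_eq_1_iff)
  show "qpoch (1 / b) (q ^ 3) k \<noteq> 0" unfolding qpoch_eq_0_iff times_divide_eq_left Q mult_1 using 2
    by (metis divide_eq_1_iff)
  show "qpoch (1 / (b * q)) (q ^ 3) N \<noteq> 0" unfolding qpoch_eq_0_iff times_divide_eq_left Q mult_1 using 3 4
    by (metis divide_eq_1_iff)
qed

lemma specializes_lhs_sum: "specializes (lhs_sum q_var a_var b_var N) (lhs_sum q a b N)"
proof -
  have "q \<noteq> 0" "a \<noteq> 0" "b \<noteq> 0" using ns by (auto simp: nonsingular_def)
  then show ?thesis unfolding lhs_sum_def
    by (intro specializes_intros q a b) (simp_all add: nonsingular_qpoch)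
qed

lemma specializes_rhs_expr:
  assumes "m = t * n"
  shows "specializes (rhs_expr q_var a_var b_var t n N) (rhs_expr q a b t n N)"
proof -
  have nz: "q \<noteq> 0" "a \<noteq> 0" "b \<noteq> 0" using ns by (auto simp: nonsingular_def)
  have "q ^ Suc 0 \<noteq> 1" using ns unfolding nonsingular_def by blast
  then have d: "a - b \<noteq> 0" "1 - a * b \<noteq> 0" "1 - q \<noteq> 0" "1 - b * q ^ (t * n - 1) \<noteq> 0" "1 - q ^ (t * n + 1) / b \<noteq> 0"
    "1 - q ^ (t * n - 1) \<noteq> 0" "1 - inverse q / b \<noteq> 0" "1 - a * b / q \<noteq> 0" "1 - b / (a * q) \<noteq> 0"
    "1 - a * inverse q \<noteq> 0" "1 - inverse q / a \<noteq> 0"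
    using ns assms by (auto simp: nonsingular_def field_simps)
  show ?thesis unfolding rhs_expr_def A_fun_def B_fun_def
    by (intro specializes_intros q a b) (use nz d nonsingular_qpoch in auto)
qed

end

end

text \<open>Here \<open>b q = Q^N\<close> is itself a power of \<open>Q\<close>, which is why
  \<open>nonsingular\<close> excludes \<open>b q = q^(3 i)\<close> only for \<open>i < N\<close>.
  The value \<open>b = q^m\<close> avoids all powers of \<open>Q\<close> because \<open>m\<close> is
  2 modulo 3.\<close>

lemma nonsingular_b:
  fixes q a :: "'a::field"
  assumes q: "q \<noteq> 0" "\<And>i j. q ^ i = q ^ j \<longleftrightarrow> i = j"
    and a: "a \<noteq> 0" "\<And>i j. a\<^sup>2 * q ^ i \<noteq> q ^ j"
    and N: "m + 1 = 3 * N"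
  shows "nonsingular q a (q ^ m) m N"
proof -
  note a1 = not_power_quotient[OF a(2)]
  have one: "q ^ i = 1 \<longleftrightarrow> i = 0" for i using q(2)[of i 0] by simp
  have m: "m \<noteq> 3 * i" "m \<ge> 2" for i using N by presburger+
  have bq: "q ^ m * q = q ^ (3 * N)" using N by (metis Suc_eq_plus1 power_Suc2)
  show ?thesis unfolding nonsingular_def bq q(2) one power_add[symmetric]
    using q(1) a(1) m N a1[of m 0] a1[of m 1] a1[of 0 m] a1[of 1 m] a1[of 0 1] a1[of 1 0]
    by auto
qed

lemma nonsingular_a:
  fixes q a b :: "'a::field"
  assumes q: "q \<noteq> 0" "\<And>i j. q ^ i = q ^ j \<longleftrightarrow> i = j"
    and b: "b \<noteq> 0" "\<And>i j. b * q ^ i \<noteq> q ^ j"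
    and a: "a = q ^ m \<or> a = 1 / q ^ m" and m: "m \<ge> 2"
  shows "nonsingular q a b m N"
proof -
  have one: "q ^ i = 1 \<longleftrightarrow> i = 0" for i using q(2)[of i 0] by simp
  have b': "q ^ j * b \<noteq> q ^ i" "q ^ i \<noteq> b * q ^ j" for i j using b(2)[of j i] by (auto simp: mult.commute)
  have "a \<noteq> 0 \<and> a \<noteq> b \<and> a * b \<noteq> 1 \<and> a * b \<noteq> q \<and> b \<noteq> a * q \<and> a \<noteq> q \<and> a * q \<noteq> 1"
    using a
  proof
    assume a: "a = q ^ m"
    show ?thesis
      using q(1) b(2)[of 0 m] b(2)[of m 0] b(2)[of m 1] b(2)[of 0 "m + 1"] q(2)[of m 1] one[of "m + 1"] m
      by (auto simp: a mult_ac)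
  next
    assume "a = 1 / q ^ m"
    then have a: "a * q ^ m = 1" using q(1) by simp
    have "a \<noteq> 0" using a by auto
    moreover have "a \<noteq> b" using a b(2)[of m 0] by auto
    moreover have "a * b \<noteq> 1"
    proof
      assume "a * b = 1"
      then have "b * q ^ 0 = q ^ m" using a \<open>a \<noteq> 0\<close> by (metis mult_left_cancel power_0 mult_1_right)
      then show False using b(2) by blast
    qed
    moreover have "a * b \<noteq> q"
    proof
      assume "a * b = q"
      then have "b * q ^ 0 = q ^ (m + 1)" using a by (metis mult.assoc mult.commute mult_1_right power_0 power_Suc2 Suc_eq_plus1)
      then show False using b(2) by blast
    qed
    moreover have "b \<noteq> a * q"
    proof
      assume "b = a * q"
      then have "b * q ^ m = q ^ 1" using a by (metis mult.assoc mult.commute mult_1_right power_one_right)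
      then show False using b(2) by blast
    qed
    moreover have "a \<noteq> q" using a one[of "m + 1"] by auto
    moreover have "a * q \<noteq> 1"
    proof
      assume "a * q = 1"
      then have "q ^ m = q ^ 1" using a \<open>a \<noteq> 0\<close> by (metis mult_left_cancel power_one_right)
      then show False using q(2)[of m 1] m by simp
    qed
    ultimately show ?thesis by blast
  qed
  then show ?thesis unfolding nonsingular_def q(2) one
    using q(1) b(1) m b(2)[of 0] b(2)[of 0 "m + 1"] b(2)[of 1] b(2)[of 1 0] b(2)[of "m - 1" 0] by auto
qed

section \<open>The concrete evaluation homomorphisms and their kernels\<close>

lemma to_fract_power: "to_fract (x ^ n) = to_fract x ^ n"
  by (induction n) simp_all

lemma linear_power_eq_iff: "[:0, 1 :: 'a::idom:] ^ i = [:0, 1:] ^ j \<longleftrightarrow> i = j"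
  by (metis degree_linear_power)

text \<open>As \<open>b\<close> is the outermost variable, this is ordinary evaluation, and the
  factor theorem identifies the kernel.\<close>

lemma specialization_eval_b:
  "specialization (\<lambda>P :: qab_poly. to_fract (poly P \<beta>)) [:- \<beta>, 1:]"
  by unfold_locales (simp_all add: poly_eq_0_iff_dvd)

lemma map_poly_add_hom:
  assumes "h 0 = 0" "\<And>x y. h (x + y) = h x + h y"
  shows "map_poly h (p + r) = map_poly h p + map_poly h r"
  by (rule poly_eqI) (simp add: coeff_map_poly assms)

lemma map_poly_mult_hom:
  assumes "h 0 = 0" "\<And>x y. h (x + y) = h x + h y" "\<And>x y. h (x * y) = h x * h y"
  shows "map_poly h (p * r) = map_poly h p * map_poly h r"
proof (rule poly_eqI)
  fix n
  have "h (\<Sum>i\<in>S. f i) = (\<Sum>i\<in>S. h (f i))" for S :: "nat set" and f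
    by (induction S rule: infinite_finite_induct) (simp_all add: assms)
  then show "coeff (map_poly h (p * r)) n = coeff (map_poly h p * map_poly h r) n"
    by (simp add: coeff_map_poly coeff_mult assms)
qed

text \<open>The variable \<open>a\<close> sits one level below \<open>b\<close>, and its value
  \<open>q^-m\<close> is not a polynomial. So every coefficient is evaluated in the rational
  functions of \<open>q\<close>, leaving a polynomial in \<open>b\<close> over that field.\<close>

definition eval_a :: "rat poly fract \<Rightarrow> qab_poly \<Rightarrow> rat poly fract poly fract" where
  "eval_a x P = to_fract (map_poly (\<lambda>c. poly (fract_poly c) x) P)"

text \<open>Gauss's lemma: a primitive linear polynomial in \<open>a\<close> divides over the
  polynomials in \<open>q\<close> as soon as it divides over their fraction field, where
  divisibility means vanishing at the root. A polynomial in \<open>b\<close> is then tested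
  coefficientwise.\<close>

lemma specialization_eval_a:
  fixes c0 c1 :: "rat poly"
  assumes "c1 \<noteq> 0" "content [:c0, c1:] = 1" "x = - to_fract c0 / to_fract c1"
  shows "specialization (eval_a x) [:[:c0, c1:]:]"
proof
  let ?h = "\<lambda>c. poly (fract_poly c) x"
  show "eval_a x (P + R) = eval_a x P + eval_a x R" for P R
    unfolding eval_a_def by (subst map_poly_add_hom) simp_all
  show "eval_a x (P * R) = eval_a x P * eval_a x R" for P R
    unfolding eval_a_def by (subst map_poly_mult_hom) simp_all
  show "eval_a x 1 = 1" by (simp add: eval_a_def)
  show "[:[:c0, c1:]:] \<noteq> 0" using assms(1) by simp
  have h: "?h c = 0 \<longleftrightarrow> [:c0, c1:] dvd c" for c
  proof -
    have eq: "fract_poly [:c0, c1:] = smult (to_fract c1) [:- x, 1:]"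
      using assms(1,3) by (simp add: map_poly_pCons)
    have "fract_poly [:c0, c1:] dvd fract_poly c \<longleftrightarrow> ?h c = 0"
      unfolding eq smult_dvd_iff poly_eq_0_iff_dvd using assms(1) by simp
    then show ?thesis using fract_poly_dvdD[OF _ assms(2)] fract_poly_dvd by blast
  qed
  show "eval_a x P = 0 \<longleftrightarrow> [:[:c0, c1:]:] dvd P" for P
    by (simp add: eval_a_def const_poly_dvd_iff poly_eq_iff coeff_map_poly flip: h)
qed

lemma eval_a_vars:
  "eval_a x q_poly = to_fract [:to_fract [:0, 1:]:]" "eval_a x a_poly = to_fract [:x:]"
  "eval_a x b_poly = to_fract [:0, 1:]"
  by (simp_all add: eval_a_def q_poly_def a_poly_def b_poly_def map_poly_pCons)

section \<open>The congruence modulo each prime factor\<close>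

lemma congruence_b:
  fixes t n N :: nat
  assumes N: "t * n + 1 = 3 * N"
  defines "p \<equiv> b_poly - q_poly ^ (t * n)"
  defines "x \<equiv> lhs_sum q_var a_var b_var N" and "y \<equiv> rhs_expr q_var a_var b_var t n N"
  shows "coprime (snd (quot_of_fract x)) p" "coprime (snd (quot_of_fract y)) p"
    "p dvd fst (quot_of_fract (x - y))"
proof -
  define \<beta> :: "rat poly poly" where "\<beta> = [:[:0, 1:]:] ^ (t * n)"
  define q a :: "rat poly poly fract" where "q = to_fract [:[:0, 1:]:]" and "a = to_fract [:0, 1:]"
  have p: "p = [:- \<beta>, 1:]"
    by (simp add: p_def b_poly_def q_poly_def \<beta>_def poly_const_pow)
  interpret specialization "\<lambda>P. to_fract (poly P \<beta>)" p
    unfolding p by (rule specialization_eval_b)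
  have qp: "q ^ i = to_fract [:[:0, 1:] ^ i:]" for i
    by (simp add: q_def poly_const_pow flip: to_fract_power)
  have sq: "specializes q_var q" and sa: "specializes a_var a" and sb: "specializes b_var (q ^ (t * n))"
    using specializes_to_fract[of q_poly] specializes_to_fract[of a_poly] specializes_to_fract[of b_poly]
    by (simp_all add: q_var_def a_var_def b_var_def q_poly_def a_poly_def b_poly_def q_def a_def \<beta>_def to_fract_power)
  have q: "q \<noteq> 0" "\<And>i j. q ^ i = q ^ j \<longleftrightarrow> i = j"
    unfolding qp by (simp_all add: q_def linear_power_eq_iff)
  have a: "a \<noteq> 0" "\<And>i j. a\<^sup>2 * q ^ i \<noteq> q ^ j"
    unfolding qp by (simp_all add: a_def power2_eq_square flip: to_fract_mult)
  note ns = nonsingular_b[OF q a N]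
  show "coprime (snd (quot_of_fract x)) p" "coprime (snd (quot_of_fract y)) p"
    "p dvd fst (quot_of_fract (x - y))"
    using specializes_lhs_sum[OF sq sa sb ns] specializes_rhs_expr[OF sq sa sb ns refl]
      specialization_b[OF q a N] coprime_snd_quot_of_fract p_dvd_fst_quot_of_fract_diff
    unfolding x_def y_def by auto
qed

text \<open>Both factors containing \<open>a\<close> are primitive and linear in \<open>a\<close>,
  so one argument covers them. Coprimality with the other factors comes from the same evaluation: a
  prime is coprime to whatever does not vanish at its root.\<close>

lemma congruence_a:
  fixes t n N :: nat
  assumes N: "t * n + 1 = 3 * N"
    and p: "p = 1 - a_poly * q_poly ^ (t * n) \<or> p = a_poly - q_poly ^ (t * n)"
  defines "x \<equiv> lhs_sum q_var a_var b_var N" and "y \<equiv> rhs_expr q_var a_var b_var t n N"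
  shows "coprime (snd (quot_of_fract x)) p" "coprime (snd (quot_of_fract y)) p"
    "p dvd fst (quot_of_fract (x - y))"
    "p \<noteq> a_poly - q_poly ^ (t * n) \<Longrightarrow> coprime p (a_poly - q_poly ^ (t * n))"
    "coprime p (b_poly - q_poly ^ (t * n))"
proof -
  define X :: "rat poly" where "X = [:0, 1:]"
  \<comment> \<open>\<open>p\<close> is written as \<open>c0 + c1 a\<close>; one coefficient is 1,
    so the content is 1, and the root \<open>v\<close> is \<open>q^m\<close> or
    \<open>q^-m\<close>.\<close>
  define c0 c1 where "c0 = (if p = a_poly - q_poly ^ (t * n) then - (X ^ (t * n)) else 1)"
    and "c1 = (if p = a_poly - q_poly ^ (t * n) then 1 else - (X ^ (t * n)))"
  define v where "v = - to_fract c0 / to_fract c1"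
  define q b :: "rat poly fract poly fract" where "q = to_fract [:to_fract X:]" and "b = to_fract [:0, 1:]"
  define a :: "rat poly fract poly fract" where "a = to_fract [:v:]"
  have p': "p = [:[:c0, c1:]:]"
    using p by (auto simp: c0_def c1_def a_poly_def q_poly_def X_def poly_const_pow one_pCons)
  interpret specialization "eval_a v" p
    unfolding p'
  proof (rule specialization_eval_a)
    show "c1 \<noteq> 0" by (simp add: c1_def X_def)
    show "content [:c0, c1:] = 1" by (simp add: content_def c0_def c1_def X_def)
  qed (simp add: v_def)
  have qp: "q ^ i = to_fract [:to_fract (X ^ i):]" for i
    by (simp add: q_def poly_const_pow to_fract_power flip: to_fract_power[where 'a = "rat poly fract poly"])
  have sq: "specializes q_var q" and sa: "specializes a_var a" and sb: "specializes b_var b"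
    using specializes_to_fract[of q_poly] specializes_to_fract[of a_poly] specializes_to_fract[of b_poly]
    by (simp_all add: q_var_def a_var_def b_var_def eval_a_vars q_def a_def b_def X_def)
  have q: "q \<noteq> 0" "\<And>i j. q ^ i = q ^ j \<longleftrightarrow> i = j"
    unfolding qp by (simp_all add: q_def X_def linear_power_eq_iff)
  have b: "b \<noteq> 0" "\<And>i j. b * q ^ i \<noteq> q ^ j"
    unfolding qp by (simp_all add: b_def X_def flip: to_fract_mult)
  have a: "a = (if p = a_poly - q_poly ^ (t * n) then q ^ (t * n) else 1 / q ^ (t * n))"
  proof (cases "p = a_poly - q_poly ^ (t * n)")
    case True
    then show ?thesis unfolding qp by (simp add: a_def v_def c0_def c1_def)
  next
    case False
    have "a * q ^ (t * n) = 1"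
      using False unfolding qp
      by (simp add: a_def v_def c0_def c1_def X_def flip: to_fract_mult one_pCons)
    then show ?thesis using False q(1) by (simp add: field_simps)
  qed
  have m: "t * n \<ge> 2" using N by (cases N) auto
  have a': "a = q ^ (t * n) \<or> a = 1 / q ^ (t * n)" using a by auto
  note ns = nonsingular_a[OF q b a' m]
  have eq: "lhs_sum q a b N = rhs_expr q a b t n N"
    using a' specialization_a_pos[OF q b N] specialization_a_neg[OF q b N] by auto
  have sx: "specializes x (lhs_sum q a b N)" unfolding x_def by (rule specializes_lhs_sum[OF sq sa sb ns])
  have sy: "specializes y (lhs_sum q a b N)"
    unfolding y_def eq by (rule specializes_rhs_expr[OF sq sa sb ns refl])
  show "coprime (snd (quot_of_fract x)) p" "coprime (snd (quot_of_fract y)) p"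
    "p dvd fst (quot_of_fract (x - y))"
    using coprime_snd_quot_of_fract[OF sx] coprime_snd_quot_of_fract[OF sy]
      p_dvd_fst_quot_of_fract_diff[OF sx sy] by simp_all
  have ev: "eval_a v q_poly = q" "eval_a v a_poly = a" "eval_a v b_poly = b"
    by (simp_all add: eval_a_vars q_def a_def b_def X_def)
  show "coprime p (b_poly - q_poly ^ (t * n))"
    using b(2)[of 0 "t * n"] by (simp add: coprime_p_iff ev_diff ev_power ev)
  show "coprime p (a_poly - q_poly ^ (t * n))" if "p \<noteq> a_poly - q_poly ^ (t * n)"
  proof -
    have "a * q ^ (t * n) = 1" using a that q(1) by simp
    moreover have "q ^ (t * n) * q ^ (t * n) \<noteq> 1" using q(2)[of "t * n + t * n" 0] m by (auto simp: power_add)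
    ultimately have "a \<noteq> q ^ (t * n)" by auto
    then show ?thesis by (simp add: coprime_p_iff ev_diff ev_power ev)
  qed
qed

theorem theorem2p2:
  fixes t n :: nat
  assumes "t \<in> {1, 2}" and "n > 0" and "[n = 3 - t] (mod 3)"
  shows "rat_cong
           ((1 - a_poly * q_poly ^ (t * n)) * (a_poly - q_poly ^ (t * n)) * (b_poly - q_poly ^ (t * n)))
           (lhs_sum q_var a_var b_var ((t * n + 1) div 3))
           (rhs_expr q_var a_var b_var t n ((t * n + 1) div 3))"
proof -
  define N where "N = (t * n + 1) div 3"
  have N: "t * n + 1 = 3 * N"
  proof -
    \<comment> \<open>For both values of \<open>t\<close> one has \<open>t (3 - t) = 2\<close>,
      hence \<open>t n\<close> is 2 modulo 3.\<close>
    have "(t * n + 1) mod 3 = 0" using assms by (auto simp: cong_def) presburger+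
    then show ?thesis unfolding N_def by presburger
  qed
  define p1 p2 p3 where "p1 = 1 - a_poly * q_poly ^ (t * n)" and "p2 = a_poly - q_poly ^ (t * n)"
    and "p3 = b_poly - q_poly ^ (t * n)"
  define x y where "x = lhs_sum q_var a_var b_var N" and "y = rhs_expr q_var a_var b_var t n N"
  have "p1 \<noteq> p2"
  proof
    assume "p1 = p2"
    \<comment> \<open>The terms free of \<open>a\<close> and \<open>b\<close> are 1 and
      \<open>- q^m\<close>, which differ since \<open>m > 0\<close>.\<close>
    then have "coeff (coeff p1 0) 0 = coeff (coeff p2 0) 0" by simp
    then have "- ([:0, 1 :: rat:] ^ (t * n)) = 1"
      by (simp add: p1_def p2_def a_poly_def q_poly_def poly_const_pow)
    then have "degree ([:0, 1 :: rat:] ^ (t * n)) = 0" by (metis degree_1 degree_minus)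
    then have "t * n = 0" by (simp add: degree_linear_power)
    then show False using N by presburger
  qed
  then have cop: "coprime p1 p2" "coprime p1 p3" "coprime p2 p3"
    using congruence_a(4,5)[OF N, of p1] congruence_a(5)[OF N, of p2] by (auto simp: p1_def p2_def p3_def)
  have "coprime (snd (quot_of_fract x)) (p1 * p2 * p3)" "coprime (snd (quot_of_fract y)) (p1 * p2 * p3)"
    using congruence_a(1,2)[OF N, of p1] congruence_a(1,2)[OF N, of p2] congruence_b(1,2)[OF N]
    by (simp_all add: p1_def p2_def p3_def x_def y_def)
  moreover have "p1 * p2 * p3 dvd fst (quot_of_fract (x - y))"
  proof (intro divides_mult)
    show "p1 dvd fst (quot_of_fract (x - y))" "p2 dvd fst (quot_of_fract (x - y))"
      using congruence_a(3)[OF N, of p1] congruence_a(3)[OF N, of p2]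
      by (simp_all add: p1_def p2_def x_def y_def)
    show "p3 dvd fst (quot_of_fract (x - y))"
      using congruence_b(3)[OF N] by (simp add: p3_def x_def y_def)
  qed (use cop in simp_all)
  ultimately show ?thesis
    unfolding rat_cong_def p1_def p2_def p3_def x_def y_def N_def by blast
qed

end
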